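(* Let $\mathbb{K}$ be a spherically complete non-Archimedean discretely valued field, with $|\mathbb{K}^*|=q^{\mathbb{Z}}$ where $q$ is the cardinality of the (finite) residue field, and let $X$ be the extended Bruhat-Tits building of $\mathrm{GL}(n,\mathbb{K})$, with vertex set $X^{(0)}$. Then the thickening of $X^{(0)}$ is a Helly graph. In particular, $\mathrm{GL}(n,\mathbb{K})$ acts properly and cocompactly by automorphisms on a Helly graph.
   Context: The vertex set $X^{(0)}$ of the extended building is the set of all ultrametric norms on $V=\mathbb{K}^n$ with values in $q^{\mathbb{Z}}\cup\{0\}$, i.e. maps $\eta:V\to q^{\mathbb{Z}}\cup\{0\}$ with $\eta(v)=0\iff v=0$, $\eta(\alpha v)=|\alpha|\eta(v)$, $\eta(u+v)\leq\max(\eta(u),\eta(v))$. It carries the metric $d(\eta,\eta')=\sup_{v\in V\setminus\{0\}}\left|\log_q\frac{\eta(v)}{\eta'(v)}\right|\in\mathbb{N}$. The thickening is the graph with vertex set $X^{(0)}$ and an edge between $\eta,\eta'$ whenever $d(\eta,\eta')=1$ (equivalently, they are at $\ell^\infty$ distance $1$ in some apartment). The group $\mathrm{GL}(n,\mathbb{K})$ acts by $g\cdot\eta=\eta\circ g^{-1}$. A connected graph is Helly if any family of pairwise intersecting combinatorial balls has a non-empty global intersection. *)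

theory Defs
  imports
    "HOL-Analysis.Analysis"
    "HOL-Algebra.Group_Action"
    "Graph_Theory.Pair_Digraph"
    "Graph_Theory.Digraph_Component"
    "Graph_Theory.Shortest_Path"
begin

section \<open>Non-Archimedean valued fields\<close>

locale nonarch_valued_field =
  fixes absv :: "'k::field \<Rightarrow> real"
  assumes absv_nonneg: "0 \<le> absv x"
    and absv_eq_0_iff: "absv x = 0 \<longleftrightarrow> x = 0"
    and absv_mult: "absv (x * y) = absv x * absv y"
    and absv_ultrametric: "absv (x + y) \<le> max (absv x) (absv y)"

definition valued_cball :: "('k::field \<Rightarrow> real) \<Rightarrow> 'k \<Rightarrow> real \<Rightarrow> 'k set" where
  "valued_cball absv x r = {y. absv (y - x) \<le> r}"

definition spherically_complete :: "('k::field \<Rightarrow> real) \<Rightarrow> bool" where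
  "spherically_complete absv \<longleftrightarrow>
     (\<forall>\<B>. \<B> \<noteq> {} \<and> \<B> \<subseteq> {valued_cball absv x r |x r. 0 < r} \<and> (\<forall>B\<in>\<B>. \<forall>C\<in>\<B>. B \<subseteq> C \<or> C \<subseteq> B)
        \<longrightarrow> \<Inter>\<B> \<noteq> {})"

definition valuation_ring :: "('k::field \<Rightarrow> real) \<Rightarrow> 'k set" where
  "valuation_ring absv = {x. absv x \<le> 1}"

text \<open>The underlying set of the quotient of the valuation ring by its maximal ideal
  \<open>{x. absv x < 1}\<close>; only its cardinality is used.\<close>
definition residue_field :: "('k::field \<Rightarrow> real) \<Rightarrow> 'k set set" where
  "residue_field absv =
     valuation_ring absv //
       {(x, y). x \<in> valuation_ring absv \<and> y \<in> valuation_ring absv \<and> absv (x - y) < 1}"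

section \<open>Helly graphs\<close>

text \<open>An undirected simple graph is a symmetric, loop-free pair digraph. The combinatorial distance
  is the shortest-path distance for unit weights.\<close>

definition combinatorial_ball :: "'v pair_pre_digraph \<Rightarrow> 'v \<Rightarrow> nat \<Rightarrow> 'v set" where
  "combinatorial_ball \<Gamma> x r =
     {y \<in> pverts \<Gamma>. wf_digraph.\<mu> (with_proj \<Gamma>) (\<lambda>_. 1) x y \<le> ereal (real r)}"

definition helly_graph :: "'v pair_pre_digraph \<Rightarrow> bool" where
  "helly_graph \<Gamma> \<longleftrightarrow>
     pair_bidirected_digraph \<Gamma> \<and> Digraph_Component.connected (with_proj \<Gamma>) \<and>
     (\<forall>\<B> \<subseteq> {combinatorial_ball \<Gamma> x r |x r. x \<in> pverts \<Gamma>}.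
        (\<forall>B\<in>\<B>. \<forall>C\<in>\<B>. B \<inter> C \<noteq> {}) \<longrightarrow> pverts \<Gamma> \<inter> \<Inter>\<B> \<noteq> {})"

section \<open>Actions on graphs\<close>

definition acts_by_automorphisms ::
    "('g, 'm) monoid_scheme \<Rightarrow> 'v pair_pre_digraph \<Rightarrow> ('g \<Rightarrow> 'v \<Rightarrow> 'v) \<Rightarrow> bool" where
  "acts_by_automorphisms G \<Gamma> \<phi> \<longleftrightarrow>
     group_action G (pverts \<Gamma>) \<phi> \<and>
     (\<forall>g\<in>carrier G. \<forall>x\<in>pverts \<Gamma>. \<forall>y\<in>pverts \<Gamma>.
        (\<phi> g x, \<phi> g y) \<in> parcs \<Gamma> \<longleftrightarrow> (x, y) \<in> parcs \<Gamma>)"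

text \<open>Here \<open>T\<close> is the topology of the acting group. Every compact subset of the geometric realization
  of the graph lies in a bounded neighbourhood of a vertex, so that compactness of the set of elements
  moving a ball to meet itself gives properness on the geometric realization as well as on the
  (discrete) vertex set.\<close>
definition acts_properly ::
    "('g, 'm) monoid_scheme \<Rightarrow> 'g topology \<Rightarrow> 'v pair_pre_digraph \<Rightarrow> ('g \<Rightarrow> 'v \<Rightarrow> 'v) \<Rightarrow> bool" where
  "acts_properly G T \<Gamma> \<phi> \<longleftrightarrow>
     continuous_map (prod_topology T (discrete_topology (pverts \<Gamma>))) (discrete_topology (pverts \<Gamma>))
       (\<lambda>(g, x). \<phi> g x) \<and>
     (\<forall>x\<in>pverts \<Gamma>. \<forall>r.
        compactin T {g \<in> carrier G. \<phi> g ` combinatorial_ball \<Gamma> x r \<inter> combinatorial_ball \<Gamma> x r \<noteq> {}})"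

text \<open>The quotient of a graph by a group of automorphisms is compact iff there are finitely many
  orbits of vertices and of edges.\<close>
definition acts_cocompactly ::
    "('g, 'm) monoid_scheme \<Rightarrow> 'v pair_pre_digraph \<Rightarrow> ('g \<Rightarrow> 'v \<Rightarrow> 'v) \<Rightarrow> bool" where
  "acts_cocompactly G \<Gamma> \<phi> \<longleftrightarrow>
     finite (orbits G (pverts \<Gamma>) \<phi>) \<and>
     finite (orbits G (parcs \<Gamma>) (\<lambda>g. map_prod (\<phi> g) (\<phi> g)))"

section \<open>The general linear group and the thickened building\<close>

definition GL :: "('k::field ^ 'n ^ 'n) monoid" where
  "GL = \<lparr>carrier = {A. invertible A}, mult = (**), one = mat 1\<rparr>"

definition matrix_dist :: "('k::field \<Rightarrow> real) \<Rightarrow> 'k ^ 'n ^ 'n \<Rightarrow> 'k ^ 'n ^ 'n \<Rightarrow> real" where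
  "matrix_dist absv A B = Max (range (\<lambda>(i, j). absv (A $ i $ j - B $ i $ j)))"

definition GL_topology :: "('k::field \<Rightarrow> real) \<Rightarrow> ('k ^ 'n ^ 'n) topology" where
  "GL_topology absv = subtopology (Metric_space.mtopology UNIV (matrix_dist absv)) (carrier GL)"

definition building_vertices :: "nat \<Rightarrow> ('k::field \<Rightarrow> real) \<Rightarrow> ('k ^ 'n \<Rightarrow> real) set" where
  "building_vertices q absv =
     {\<eta>. (\<forall>v. \<eta> v \<in> insert 0 (range (\<lambda>m::int. real q powi m))) \<and>
         (\<forall>v. \<eta> v = 0 \<longleftrightarrow> v = 0) \<and>
         (\<forall>a v. \<eta> (a *s v) = absv a * \<eta> v) \<and>
         (\<forall>u v. \<eta> (u + v) \<le> max (\<eta> u) (\<eta> v))}"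

definition building_dist :: "nat \<Rightarrow> ('k::field ^ 'n \<Rightarrow> real) \<Rightarrow> ('k ^ 'n \<Rightarrow> real) \<Rightarrow> real" where
  "building_dist q \<eta> \<eta>' = (SUP v\<in>UNIV - {0}. \<bar>log (real q) (\<eta> v / \<eta>' v)\<bar>)"

definition thickening :: "nat \<Rightarrow> ('k::field \<Rightarrow> real) \<Rightarrow> ('k ^ 'n \<Rightarrow> real) pair_pre_digraph" where
  "thickening q absv =
     \<lparr>pverts = building_vertices q absv,
      parcs = {(\<eta>, \<eta>'). \<eta> \<in> building_vertices q absv \<and> \<eta>' \<in> building_vertices q absv \<and>
                        building_dist q \<eta> \<eta>' = 1}\<rparr>"

text \<open>\<open>group_action\<close> requires each group element to act by an extensional function.\<close>
definition GL_action ::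
    "nat \<Rightarrow> ('k::field \<Rightarrow> real) \<Rightarrow> 'k ^ 'n ^ 'n \<Rightarrow> ('k ^ 'n \<Rightarrow> real) \<Rightarrow> ('k ^ 'n \<Rightarrow> real)" where
  "GL_action q absv g = (\<lambda>\<eta>\<in>building_vertices q absv. \<eta> \<circ> (\<lambda>v. matrix_inv g *v v))"

text \<open>\<open>Metric_space.mtopology\<close> is used with arguments that do form a metric space.\<close>
lemma (in nonarch_valued_field) absv_minus: "absv (- x) = absv x"
proof -
  have "absv (-1) * absv (-1) = absv (1 * 1)" "absv (1 * 1) = absv 1 * absv 1"
    by (simp_all flip: absv_mult)
  moreover have "absv 1 \<noteq> 0"
    by (simp add: absv_eq_0_iff)
  ultimately have "(absv (-1))\<^sup>2 = 1\<^sup>2"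
    by (simp add: power2_eq_square)
  then have "absv (-1) = 1"
    using absv_nonneg[of "-1"] power2_eq_imp_eq[of "absv (-1)" 1] by simp
  then show ?thesis
    using absv_mult[of "-1" x] by simp
qed

lemma (in nonarch_valued_field) Metric_space_matrix_dist:
  "Metric_space UNIV (matrix_dist absv :: 'k ^ 'n ^ 'n \<Rightarrow> _)"
proof
  fix A B C :: "'k ^ 'n ^ 'n"
  have ge: "absv (X $ i $ j - Y $ i $ j) \<le> matrix_dist absv X Y" for X Y :: "'k ^ 'n ^ 'n" and i j
    unfolding matrix_dist_def by (rule Max_ge) (auto intro!: image_eqI[where x = "(i, j)"])
  have le: "matrix_dist absv X Y \<le> c" if "\<And>i j. absv (X $ i $ j - Y $ i $ j) \<le> c"
    for X Y :: "'k ^ 'n ^ 'n" and c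
    unfolding matrix_dist_def using that by (intro Max.boundedI) auto
  show nonneg: "0 \<le> matrix_dist absv A B"
    using ge[of A undefined undefined B] absv_nonneg order_trans by blast
  show "matrix_dist absv A B = matrix_dist absv B A"
    unfolding matrix_dist_def by (metis absv_minus minus_diff_eq)
  show "matrix_dist absv A B = 0 \<longleftrightarrow> A = B"
  proof
    assume "matrix_dist absv A B = 0"
    then have "absv (A $ i $ j - B $ i $ j) = 0" for i j
      using ge[of A i j B] absv_nonneg[of "A $ i $ j - B $ i $ j"] by simp
    then show "A = B"
      by (simp add: absv_eq_0_iff vec_eq_iff)
  next
    assume "A = B"
    then have "matrix_dist absv A B \<le> 0"
      using absv_eq_0_iff[of 0] by (intro le) simp
    then show "matrix_dist absv A B = 0"
      using nonneg by simp
  qed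
  show "matrix_dist absv A C \<le> matrix_dist absv A B + matrix_dist absv B C"
  proof (rule le)
    fix i j
    show "absv (A $ i $ j - C $ i $ j) \<le> matrix_dist absv A B + matrix_dist absv B C"
      using absv_ultrametric[of "A $ i $ j - B $ i $ j" "B $ i $ j - C $ i $ j"]
        ge[of A i j B] ge[of B i j C] absv_nonneg[of "A $ i $ j - B $ i $ j"]
        absv_nonneg[of "B $ i $ j - C $ i $ j"] by simp
  qed
qed

end

theory Submission
  imports Defs
begin

text \<open>
  Two vertices are at distance at most \<open>m\<close> iff each norm is at most \<open>q ^ m\<close> times the other, so a
  ball is an order interval \<open>q powi -m * \<eta> \<le> \<zeta> \<le> q ^ m * \<eta>\<close>. A pointwise bounded supremum of norms is
  again a norm, with values in the powers of \<open>q\<close> by discreteness. Hence, for pairwise intersecting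
  balls, the supremum of the lower ends \<open>q powi -r * \<eta>\<close> is a common point; applied to two balls, this
  also yields intermediate points, so the graph distance is the distance of norms.

  Spherical completeness provides best approximations, hence orthonormal bases. Therefore the general
  linear group is transitive on norms and any two norms are equivalent. Finiteness of the residue field
  makes balls of norms finite and bounded sets of matrices totally bounded, and the set of matrices
  moving a norm by a bounded amount is uniformly open, hence closed.
\<close>

section \<open>Discrete sets of values\<close>

text \<open>The relation \<open>norm_close\<close> replaces \<open>building_dist\<close>: it avoids
  real suprema and logarithms, and it makes sense for \<open>\<lambda>v. \<eta> (A *v v)\<close>
  with \<open>A\<close> singular. Compactness can thus be proved in the space of all matrices, which
  is complete; when both norms are vertices, the lower estimate excludes a kernel, so the set lies
  in the group by itself.

  Lower and upper ends are not interchangeable: a pointwise maximum of ultrametric norms is a norm,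
  a pointwise minimum in general is not. Centres are at distance at most \<open>r + r'\<close>
  exactly when each lower end is below the other upper end, and this is all that the supremum needs.

  The obstacle for orthonormal bases is the existence of a best approximation. Powers of
  \<open>q\<close> accumulate only at 0, so it suffices that a vector outside a span has positive
  distance from it; completeness gives this.

  Openness is uniform because a perturbation that is small relative to
  \<open>\<eta>' (A *v v)\<close> does not change this value at all.\<close>

definition powers :: "nat \<Rightarrow> real set" where
  "powers q = range (\<lambda>m::int. real q powi m)"

lemma powers_pos: "a > 0" if "a \<in> powers q" "q \<ge> 2"
  using that by (auto simp: powers_def)

lemma powers_mult: "a * b \<in> powers q" if "a \<in> powers q" "b \<in> powers q" "q \<ge> 2"
proof -
  from that obtain m n where "a = real q powi m" "b = real q powi n"
    by (auto simp: powers_def)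
  then have "a * b = real q powi (m + n)"
    using that by (simp add: power_int_add)
  then show ?thesis
    by (auto simp: powers_def)
qed

lemma powers_inverse: "inverse a \<in> powers q" if "a \<in> powers q" "q \<ge> 2"
proof -
  from that obtain m where "a = real q powi m"
    by (auto simp: powers_def)
  then have "inverse a = real q powi (- m)"
    using that by (simp add: power_int_minus)
  then show ?thesis
    by (auto simp: powers_def)
qed

lemma power_in_powers: "real q ^ m \<in> powers q"
  unfolding powers_def by (rule range_eqI[of _ _ "int m"]) simp

text \<open>Integrality of exponents: \<open>m < n\<close> means \<open>m + 1 \<le> n\<close>. This
  turns strict inequalities into a factor \<open>q\<close>, both for distinct norms and for
  \<open>absv x < 1\<close>.\<close>

lemma powers_gap: "q * a \<le> b" if "a \<in> powers q" "b \<in> powers q" "a < b" "q \<ge> 2"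
proof -
  from that obtain m n where mn: "a = real q powi m" "b = real q powi n"
    by (auto simp: powers_def)
  have "m < n"
  proof (rule ccontr)
    assume "\<not> m < n"
    then have "b \<le> a"
      unfolding mn using that by (intro power_int_increasing) auto
    with that show False by simp
  qed
  then have "real q powi (m + 1) \<le> b"
    unfolding mn using that by (intro power_int_increasing) auto
  then show ?thesis
    using that mn by (simp add: power_int_add mult.commute)
qed

lemma power_unbounded: "\<exists>m::nat. B \<le> real q ^ m" if "q \<ge> 2"
  using real_arch_pow[of "real q" B] that by (auto intro: less_imp_le)

lemma powers_max:
  assumes "S \<subseteq> powers q" "S \<noteq> {}" "q \<ge> 2" and bdd: "\<And>a. a \<in> S \<Longrightarrow> a \<le> B"
  shows "\<exists>a\<in>S. \<forall>b\<in>S. b \<le> a"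
proof -
  obtain N :: nat where N: "B \<le> real q ^ N"
    using power_unbounded assms by blast
  \<comment> \<open>Members of \<open>S\<close> are indexed downwards from the bound
    \<open>real q ^ N\<close>, so the largest member belongs to the least index and well-ordering of
    the naturals applies.\<close>
  define P where "P k \<longleftrightarrow> real q powi (int N - int k) \<in> S" for k :: nat
  have P: "\<exists>k. P k \<and> b = real q powi (int N - int k)" if "b \<in> S" for b
  proof -
    from that assms obtain m where m: "b = real q powi m"
      by (auto simp: powers_def)
    have "m \<le> int N"
    proof (rule power_int_le_imp_le_exp)
      show "real q powi m \<le> real q powi int N"
        using N bdd[OF that] m by simp
    qed (use assms in auto)
    then show ?thesis
      using m that by (intro exI[of _ "nat (int N - m)"]) (auto simp: P_def)
  qed
  obtain b0 where "b0 \<in> S"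
    using assms by blast
  then have ex: "\<exists>k. P k"
    using P by blast
  define k where "k = (LEAST k. P k)"
  have "P k"
    unfolding k_def using ex by (rule LeastI_ex)
  moreover have "b \<le> real q powi (int N - int k)" if b: "b \<in> S" for b
  proof -
    obtain l where l: "P l" "b = real q powi (int N - int l)"
      using P[OF b] by blast
    have "k \<le> l"
      unfolding k_def using l by (intro Least_le)
    then show ?thesis
      unfolding l using assms by (intro power_int_increasing) auto
  qed
  ultimately show ?thesis
    unfolding P_def by blast
qed

text \<open>Inversion exchanges minima and maxima. The positive lower bound \<open>c\<close> is
  essential, since the powers of \<open>q\<close> accumulate at 0.\<close>

lemma powers_min:
  assumes "S \<subseteq> powers q" "S \<noteq> {}" "q \<ge> 2" "0 < c" and bdd: "\<And>a. a \<in> S \<Longrightarrow> c \<le> a"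
  shows "\<exists>a\<in>S. \<forall>b\<in>S. a \<le> b"
proof -
  have pos: "a > 0" if "a \<in> S" for a
    using bdd[OF that] assms by simp
  have "\<exists>a\<in>inverse ` S. \<forall>b\<in>inverse ` S. b \<le> a"
  proof (rule powers_max)
    show "inverse ` S \<subseteq> powers q"
      using assms powers_inverse by blast
    show "a \<le> inverse c" if "a \<in> inverse ` S" for a
      using that assms bdd by (auto intro!: le_imp_inverse_le)
  qed (use assms in auto)
  then show ?thesis
    using pos by auto
qed

section \<open>Norms with values in the powers of \<open>q\<close>\<close>

lemma building_vertices_iff:
  "\<eta> \<in> building_vertices q absv \<longleftrightarrow>
     (\<forall>v. v \<noteq> 0 \<longrightarrow> \<eta> v \<in> powers q) \<and> \<eta> 0 = 0 \<and>
     (\<forall>a v. \<eta> (a *s v) = absv a * \<eta> v) \<and> (\<forall>u v. \<eta> (u + v) \<le> max (\<eta> u) (\<eta> v))"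
  if "q \<ge> 2"
proof -
  have "0 \<notin> powers q"
    using powers_pos[of 0 q] that by auto
  then show ?thesis
    unfolding building_vertices_def powers_def[symmetric] by auto metis+
qed

locale ultrametric_local_field = nonarch_valued_field absv
  for absv :: "'k::field \<Rightarrow> real" +
  fixes q :: nat
  assumes complete: "spherically_complete absv"
    and finite_residue_field: "finite (residue_field absv)"
    and q_ge_2: "q \<ge> 2"
    and absv_image: "absv ` (UNIV - {0}) = powers q"
begin

lemma absv_0 [simp]: "absv 0 = 0"
  by (simp add: absv_eq_0_iff)

lemma absv_1 [simp]: "absv 1 = 1"
  using absv_mult[of 1 1] absv_eq_0_iff[of 1] by simp

lemma q_pos: "real q > 1" "real q > 0" "real q \<ge> 1" "real q \<noteq> 0"
  using q_ge_2 by auto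

lemma absv_diff_ultrametric: "absv (x - y) \<le> max (absv x) (absv y)"
  using absv_ultrametric[of x "- y"] by (simp add: absv_minus)

lemma absv_in_powers: "x \<noteq> 0 \<Longrightarrow> absv x \<in> powers q"
  using absv_image by blast

lemma absv_inverse: "absv (inverse x) = inverse (absv x)"
  using absv_mult[of x "inverse x"] by (cases "x = 0") (auto simp: field_simps absv_eq_0_iff)

lemma ex_absv_eq:
  assumes "a \<in> powers q"
  obtains x where "x \<noteq> 0" "absv x = a"
  using assms absv_image by (metis DiffD2 imageE insertI1)

context
  fixes \<eta> :: "'k ^ 'n \<Rightarrow> real"
  assumes \<eta>: "\<eta> \<in> building_vertices q absv"
begin

lemma vertex_zero [simp]: "\<eta> 0 = 0"
  and vertex_scale: "\<eta> (a *s v) = absv a * \<eta> v"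
  and vertex_add: "\<eta> (u + v) \<le> max (\<eta> u) (\<eta> v)"
  and vertex_in_powers: "v \<noteq> 0 \<Longrightarrow> \<eta> v \<in> powers q"
  using \<eta> building_vertices_iff[OF q_ge_2] by blast+

lemma vertex_pos: "v \<noteq> 0 \<Longrightarrow> \<eta> v > 0"
  using vertex_in_powers powers_pos q_ge_2 by blast

lemma vertex_nonneg: "\<eta> v \<ge> 0"
  using vertex_pos[of v] by (cases "v = 0") auto

lemma vertex_eq_0_iff: "\<eta> v = 0 \<longleftrightarrow> v = 0"
  using vertex_pos[of v] by (cases "v = 0") auto

lemma vertex_minus: "\<eta> (- v) = \<eta> v"
  using vertex_scale[of "-1" v] absv_minus[of 1] by simp

lemma vertex_diff: "\<eta> (u - v) \<le> max (\<eta> u) (\<eta> v)"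
  using vertex_add[of u "- v"] by (simp add: vertex_minus)

text \<open>The isosceles property: writing \<open>u = (u + v) - v\<close>, the smaller term
  \<open>\<eta> v\<close> cannot account for \<open>\<eta> u\<close>, so
  \<open>\<eta> (u + v)\<close> must.\<close>

lemma vertex_add_eq: "\<eta> (u + v) = \<eta> u" if "\<eta> v < \<eta> u"
  using vertex_add[of u v] vertex_diff[of "u + v" v] that by (auto simp: max_def split: if_splits)

lemma vertex_sum_le: "\<eta> (\<Sum>i\<in>I. f i) \<le> c" if "\<And>i. i \<in> I \<Longrightarrow> \<eta> (f i) \<le> c" "c \<ge> 0"
  using that
proof (induction I rule: infinite_finite_induct)
  case (insert i I)
  then have "max (\<eta> (f i)) (\<eta> (sum f I)) \<le> c"
    by simp
  then show ?case
    using vertex_add[of "f i" "sum f I"] insert by (simp del: max.bounded_iff)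
qed auto

end


section \<open>Orthonormal bases\<close>

text \<open>This is the entry point of spherical completeness. Every point of an ultrametric ball is
  a centre of it, so the balls around \<open>x m\<close> with radii
  \<open>inverse (real q ^ m)\<close> form a decreasing chain; a common point is the limit.\<close>

lemma nested_limit:
  assumes "\<And>m n. m \<le> n \<Longrightarrow> absv (x n - x m) \<le> inverse (real q ^ m)"
  shows "\<exists>l. \<forall>m. absv (l - x m) \<le> inverse (real q ^ m)"
proof -
  define B where "B m = valued_cball absv (x m) (inverse (real q ^ m))" for m
  have mono: "B n \<subseteq> B m" if "m \<le> n" for m n
  proof
    fix y assume "y \<in> B n"
    then have "absv (y - x n) \<le> inverse (real q ^ n)"
      by (simp add: B_def valued_cball_def)
    also have "\<dots> \<le> inverse (real q ^ m)"
      using that q_pos by (intro le_imp_inverse_le power_increasing) auto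
    finally have "absv ((y - x n) + (x n - x m)) \<le> inverse (real q ^ m)"
      using assms[OF that] by (intro order_trans[OF absv_ultrametric]) simp
    then show "y \<in> B m"
      by (simp add: B_def valued_cball_def)
  qed
  have "\<Inter>(range B) \<noteq> {}"
  proof (rule complete[unfolded spherically_complete_def, rule_format], intro conjI)
    show "range B \<subseteq> {valued_cball absv x r |x r. 0 < r}"
    proof -
      have "0 < inverse (real q ^ m)" for m
        using q_pos by simp
      then show ?thesis
        unfolding B_def by blast
    qed
    show "\<forall>C\<in>range B. \<forall>D\<in>range B. C \<subseteq> D \<or> D \<subseteq> C"
      using mono by (metis imageE nat_le_linear)
  qed auto
  then show ?thesis
    unfolding B_def valued_cball_def by auto
qed

lemma le_inverse_powers_imp_le_0: "c \<le> 0" if "\<And>m. c \<le> inverse (real q ^ m)"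
proof (rule ccontr)
  assume "\<not> c \<le> 0"
  moreover obtain m where "inverse c + 1 \<le> real q ^ m"
    using power_unbounded[OF q_ge_2] by blast
  ultimately have "inverse c < real q ^ m" "c > 0" by auto
  then have "inverse (real q ^ m) < c"
    using less_imp_inverse_less[of "inverse c" "real q ^ m"] by simp
  with that[of m] show False by simp
qed

end

text \<open>In coordinates the norm is the maximum norm; \<open>insert 0\<close> gives the empty
  family the value 0. For a vertex \<open>\<eta>\<close> and finite \<open>J\<close>, the identity
  for all coefficients already contains unit length and linear independence.\<close>

definition orthonormal :: "('k::field \<Rightarrow> real) \<Rightarrow> ('k ^ 'n \<Rightarrow> real) \<Rightarrow> ('j \<Rightarrow> 'k ^ 'n) \<Rightarrow> 'j set \<Rightarrow> bool" where
  "orthonormal absv \<eta> b J \<longleftrightarrow>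
     (\<forall>a. \<eta> (\<Sum>j\<in>J. a j *s b j) = Max (insert 0 ((\<lambda>j. absv (a j)) ` J)))"

context ultrametric_local_field begin

lemma best_approximation:
  fixes \<eta> :: "'k ^ 'n \<Rightarrow> real" and b :: "'j \<Rightarrow> 'k ^ 'n"
  assumes \<eta>: "\<eta> \<in> building_vertices q absv" and J: "finite J" "orthonormal absv \<eta> b J"
    and e: "\<And>a. e \<noteq> (\<Sum>j\<in>J. a j *s b j)"
  obtains a where "\<And>a'. \<eta> (e - (\<Sum>j\<in>J. a j *s b j)) \<le> \<eta> (e - (\<Sum>j\<in>J. a' j *s b j))"
proof -
  define w where "w a = (\<Sum>j\<in>J. a j *s b j)" for a
  have w_diff: "w a - w a' = w (\<lambda>j. a j - a' j)" for a a'
    by (simp add: w_def vec.scale_left_diff_distrib sum_subtractf)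
  have \<eta>_w: "\<eta> (w a) = Max (insert 0 ((\<lambda>j. absv (a j)) ` J))" for a
    using J unfolding orthonormal_def w_def by blast
  \<comment> \<open>The distance from \<open>e\<close> to the span is positive. Otherwise there are
    ever better approximations; orthonormality turns their closeness into closeness of coefficients,
    these converge, and the limit combination equals \<open>e\<close>.\<close>
  have "\<exists>m. \<forall>a. inverse (real q ^ m) \<le> \<eta> (e - w a)"
  proof (rule ccontr)
    assume "\<not> ?thesis"
    then have "\<forall>m. \<exists>a. \<eta> (e - w a) < inverse (real q ^ m)"
      by (auto simp: not_le)
    then obtain a where a: "\<And>m. \<eta> (e - w (a m)) < inverse (real q ^ m)"
      by metis
    have close: "absv (a n j - a m j) \<le> inverse (real q ^ m)" if "j \<in> J" "m \<le> n" for j m n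
    proof -
      have "\<eta> (e - w (a n)) \<le> inverse (real q ^ m)"
        using that q_pos a[of n]
        by (intro order_trans[OF less_imp_le[OF a]] le_imp_inverse_le power_increasing) auto
      then have "\<eta> ((e - w (a m)) - (e - w (a n))) \<le> inverse (real q ^ m)"
        using a[of m] by (intro order_trans[OF vertex_diff[OF \<eta>]]) simp
      then have "\<eta> (w (\<lambda>j. a n j - a m j)) \<le> inverse (real q ^ m)"
        by (simp flip: w_diff)
      then show ?thesis
        using J(1) that by (simp add: \<eta>_w)
    qed
    have "\<exists>l. \<forall>j\<in>J. \<forall>m. absv (l j - a m j) \<le> inverse (real q ^ m)"
      by (rule bchoice) (intro ballI nested_limit close)
    then obtain l where l: "\<And>j m. j \<in> J \<Longrightarrow> absv (l j - a m j) \<le> inverse (real q ^ m)"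
      by blast
    have "\<eta> (e - w l) \<le> inverse (real q ^ m)" for m
    proof -
      have "\<eta> (w l - w (a m)) \<le> inverse (real q ^ m)"
        unfolding w_diff \<eta>_w using l J(1) by auto
      then have "\<eta> ((e - w (a m)) - (w l - w (a m))) \<le> inverse (real q ^ m)"
        using a[of m] by (intro order_trans[OF vertex_diff[OF \<eta>]]) simp
      then show ?thesis by simp
    qed
    then have "\<eta> (e - w l) = 0"
      using le_inverse_powers_imp_le_0 vertex_nonneg[OF \<eta>] by (meson antisym)
    then have "e = w l"
      using vertex_eq_0_iff[OF \<eta>] by simp
    with e[of l] show False
      by (simp add: w_def)
  qed
  then obtain m where m: "\<And>a. inverse (real q ^ m) \<le> \<eta> (e - w a)"
    by blast
  \<comment> \<open>Values bounded away from 0 within the powers of \<open>q\<close> attain their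
    minimum.\<close>
  have "\<exists>x\<in>range (\<lambda>a. \<eta> (e - w a)). \<forall>y\<in>range (\<lambda>a. \<eta> (e - w a)). x \<le> y"
  proof (rule powers_min[OF _ _ q_ge_2])
    show "range (\<lambda>a. \<eta> (e - w a)) \<subseteq> powers q"
      using e vertex_in_powers[OF \<eta>] by (auto simp: w_def)
    show "0 < inverse (real q ^ m)"
      using q_pos by simp
  qed (use m in auto)
  then show ?thesis
    using that unfolding w_def by auto
qed

text \<open>The new vector has norm 1 and distance at least 1 from the span, so no cancellation with
  the span can lower the contribution of its coefficient.\<close>

lemma orthonormal_insert:
  fixes \<eta> :: "'k ^ 'n \<Rightarrow> real" and b :: "'j \<Rightarrow> 'k ^ 'n"
  assumes \<eta>: "\<eta> \<in> building_vertices q absv" and J: "finite J" "orthonormal absv \<eta> b J"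
    and k: "k \<notin> J" "\<eta> (b k) = 1" and min: "\<And>a. 1 \<le> \<eta> (b k - (\<Sum>j\<in>J. a j *s b j))"
  shows "orthonormal absv \<eta> b (insert k J)"
  unfolding orthonormal_def
proof
  fix a
  define w where "w a = (\<Sum>j\<in>J. a j *s b j)" for a
  have \<eta>_w: "\<eta> (w a) = Max (insert 0 ((\<lambda>j. absv (a j)) ` J))"
    using J unfolding orthonormal_def w_def by blast
  \<comment> \<open>Dividing by \<open>a k\<close> turns the sum into a multiple of
    \<open>b k\<close> minus a vector of the span, to which the distance bound applies.\<close>
  have ge: "absv (a k) \<le> \<eta> (a k *s b k + w a)"
  proof (cases "a k = 0")
    case True
    then show ?thesis by (simp add: vertex_nonneg[OF \<eta>])
  next
    case False
    have "a k *s w (\<lambda>j. - a j / a k) = w (\<lambda>j. - a j)"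
      using False by (simp add: w_def vec.scale_sum_right)
    also have "\<dots> = - w a"
      by (simp add: w_def sum_negf)
    finally have "a k *s b k + w a = a k *s (b k - w (\<lambda>j. - a j / a k))"
      by (simp add: vec.scale_right_diff_distrib)
    then have "\<eta> (a k *s b k + w a) = absv (a k) * \<eta> (b k - w (\<lambda>j. - a j / a k))"
      by (simp only: vertex_scale[OF \<eta>])
    moreover have "1 \<le> \<eta> (b k - w (\<lambda>j. - a j / a k))"
      unfolding w_def by (rule min)
    ultimately show ?thesis
      using mult_left_mono[OF _ absv_nonneg, of 1 _ "a k"] by simp
  qed
  \<comment> \<open>If \<open>absv (a k)\<close> dominates, \<open>ge\<close> meets the ultrametric
    upper bound; otherwise the span part strictly dominates and the isosceles property
    applies.\<close>
  have "\<eta> (a k *s b k + w a) = max (absv (a k)) (\<eta> (w a))"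
  proof (cases "\<eta> (w a) \<le> absv (a k)")
    case True
    then show ?thesis
      using ge vertex_add[OF \<eta>, of "a k *s b k" "w a"] k by (simp add: vertex_scale[OF \<eta>])
  next
    case False
    then have "\<eta> (a k *s b k) < \<eta> (w a)"
      using k by (simp add: vertex_scale[OF \<eta>])
    then show ?thesis
      using vertex_add_eq[OF \<eta>, of "a k *s b k" "w a"] False by (simp add: add.commute)
  qed
  also have "\<dots> = Max (insert (absv (a k)) (insert 0 ((\<lambda>j. absv (a j)) ` J)))"
    using J(1) by (simp add: \<eta>_w)
  finally show "\<eta> (\<Sum>j\<in>insert k J. a j *s b j) = Max (insert 0 ((\<lambda>j. absv (a j)) ` insert k J))"
    using J(1) k by (simp add: w_def insert_commute)
qed

text \<open>Gram-Schmidt without an inner product: a best approximation replaces the orthogonal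
  projection, and the remainder is then normalised.\<close>

lemma orthonormal_extend:
  fixes \<eta> :: "'k ^ 'n \<Rightarrow> real" and b :: "'j \<Rightarrow> 'k ^ 'n"
  assumes \<eta>: "\<eta> \<in> building_vertices q absv" and J: "finite J" "orthonormal absv \<eta> b J"
    and k: "k \<notin> J" and e: "\<And>a. e \<noteq> (\<Sum>j\<in>J. a j *s b j)"
  obtains a c where "orthonormal absv \<eta> (b(k := c *s (e - (\<Sum>j\<in>J. a j *s b j)))) (insert k J)"
proof -
  obtain a where a: "\<And>a'. \<eta> (e - (\<Sum>j\<in>J. a j *s b j)) \<le> \<eta> (e - (\<Sum>j\<in>J. a' j *s b j))"
    using best_approximation[OF \<eta> J e] by blast
  define r where "r = \<eta> (e - (\<Sum>j\<in>J. a j *s b j))"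
  have r: "r \<in> powers q"
    unfolding r_def using e by (intro vertex_in_powers[OF \<eta>]) simp
  \<comment> \<open>A scalar of size exactly \<open>inverse r\<close> exists because norms and
    \<open>absv\<close> take the same nonzero values.\<close>
  then obtain c where c: "c \<noteq> 0" "absv c = inverse r"
    using ex_absv_eq powers_inverse q_ge_2 by metis
  have "r > 0"
    using r powers_pos q_ge_2 by blast
  define b' where "b' = b(k := c *s (e - (\<Sum>j\<in>J. a j *s b j)))"
  have sum: "(\<Sum>j\<in>J. f j *s b' j) = (\<Sum>j\<in>J. f j *s b j)" for f
    using k by (intro sum.cong) (auto simp: b'_def)
  have "orthonormal absv \<eta> b' (insert k J)"
  proof (rule orthonormal_insert[OF \<eta> J(1) _ k])
    show "orthonormal absv \<eta> b' J"
      using J(2) unfolding orthonormal_def sum .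
    show "\<eta> (b' k) = 1"
      unfolding b'_def fun_upd_same vertex_scale[OF \<eta>] r_def[symmetric] using \<open>r > 0\<close> c by simp
    fix f
    \<comment> \<open>Any competitor for the new vector is \<open>c\<close> times a competitor for
      \<open>e\<close>, with shifted coefficients, so minimality of \<open>a\<close> carries
      over.\<close>
    have "c *s (\<Sum>j\<in>J. (f j / c) *s b j) = (\<Sum>j\<in>J. f j *s b j)"
      using c by (simp add: vec.scale_sum_right)
    then have "b' k - (\<Sum>j\<in>J. f j *s b' j) = c *s (e - (\<Sum>j\<in>J. (a j + f j / c) *s b j))"
      unfolding sum by (simp add: b'_def vec.scale_right_diff_distrib vec.scale_left_distrib sum.distrib
          vec.scale_right_distrib)
    moreover have "r \<le> \<eta> (e - (\<Sum>j\<in>J. (a j + f j / c) *s b j))"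
      unfolding r_def by (rule a)
    ultimately show "1 \<le> \<eta> (b' k - (\<Sum>j\<in>J. f j *s b' j))"
      using \<open>r > 0\<close> c by (simp only: vertex_scale[OF \<eta>]) (simp add: field_simps)
  qed
  then show ?thesis
    using that unfolding b'_def by blast
qed

text \<open>The support condition strengthens the induction: it keeps \<open>axis k 1\<close>
  outside the span for the next index \<open>k\<close>, without a dimension count. Indexing by
  coordinates lets the final basis serve as the columns of a square matrix.\<close>

lemma ex_orthonormal:
  fixes \<eta> :: "'k ^ 'n \<Rightarrow> real" and J :: "'n set"
  assumes \<eta>: "\<eta> \<in> building_vertices q absv"
  shows "\<exists>b. orthonormal absv \<eta> b J \<and> (\<forall>j\<in>J. \<forall>i. i \<notin> J \<longrightarrow> b j $ i = 0)"
  using finite[of J]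
proof (induction J)
  case empty
  then show ?case by (simp add: orthonormal_def vertex_zero[OF \<eta>])
next
  case (insert k J)
  then obtain b where b: "orthonormal absv \<eta> b J" "\<And>j i. j \<in> J \<Longrightarrow> i \<notin> J \<Longrightarrow> b j $ i = 0"
    by blast
  have sum: "(\<Sum>j\<in>J. a j *s b j) $ i = 0" if "i \<notin> J" for a i
    using b(2)[OF _ that] by (simp add: sum.neutral)
  have e: "axis k 1 \<noteq> (\<Sum>j\<in>J. a j *s b j)" for a
    using sum[OF insert.hyps(2), of a] by (metis axis_nth zero_neq_one)
  obtain a c where ac: "orthonormal absv \<eta> (b(k := c *s (axis k 1 - (\<Sum>j\<in>J. a j *s b j)))) (insert k J)"
    using orthonormal_extend[OF \<eta> insert.hyps(1) b(1) insert.hyps(2) e] by blast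
  show ?case
  proof (intro exI conjI ballI allI impI, rule ac)
    fix j i assume "j \<in> insert k J" "i \<notin> insert k J"
    then show "(b(k := c *s (axis k 1 - (\<Sum>j\<in>J. a j *s b j)))) j $ i = 0"
      using b(2) sum[of i a] by (auto simp: axis_def)
  qed
qed

end

section \<open>The standard norm, equivalence of norms and the distance in multiplicative
  form\<close>

definition std_norm :: "('k::field \<Rightarrow> real) \<Rightarrow> 'k ^ 'n \<Rightarrow> real" where
  "std_norm absv v = Max (range (\<lambda>i. absv (v $ i)))"

text \<open>For vertices this is \<open>building_dist q \<eta> \<eta>' \<le> real m\<close>. Nothing
  is required of the two functions, so that it also applies to a norm composed with a singular
  matrix.\<close>

definition norm_close :: "nat \<Rightarrow> nat \<Rightarrow> ('v \<Rightarrow> real) \<Rightarrow> ('v \<Rightarrow> real) \<Rightarrow> bool" where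
  "norm_close q m \<eta> \<eta>' \<longleftrightarrow> (\<forall>v. \<eta> v \<le> real q ^ m * \<eta>' v \<and> \<eta>' v \<le> real q ^ m * \<eta> v)"

lemma norm_close_sym: "norm_close q m \<eta> \<eta>' \<longleftrightarrow> norm_close q m \<eta>' \<eta>"
  by (auto simp: norm_close_def)

lemma norm_close_0_iff: "norm_close q 0 \<eta> \<eta>' \<longleftrightarrow> \<eta> = \<eta>'"
  by (auto simp: norm_close_def fun_eq_iff intro: antisym)

lemma norm_close_trans:
  "norm_close q m \<eta> \<eta>' \<Longrightarrow> norm_close q n \<eta>' \<eta>'' \<Longrightarrow> norm_close q (m + n) \<eta> \<eta>''"
proof -
  assume *: "norm_close q m \<eta> \<eta>'" "norm_close q n \<eta>' \<eta>''"
  have "real q ^ m * \<eta>' v \<le> real q ^ m * (real q ^ n * \<eta>'' v)"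
    and "real q ^ n * \<eta>' v \<le> real q ^ n * (real q ^ m * \<eta> v)" for v
    using * by (auto simp: norm_close_def intro!: mult_left_mono)
  with * show "norm_close q (m + n) \<eta> \<eta>''"
    unfolding norm_close_def power_add by (smt (verit) mult.assoc mult.commute)
qed

lemma matrix_inv_cancel:
  fixes A :: "'k::field ^ 'n ^ 'n"
  assumes "invertible A"
  shows "A ** matrix_inv A = mat 1" "matrix_inv A ** A = mat 1"
    "A *v (matrix_inv A *v v) = v" "matrix_inv A *v (A *v v) = v"
proof -
  have "A ** matrix_inv A = mat 1 \<and> matrix_inv A ** A = mat 1"
    using someI_ex[OF assms[unfolded invertible_def]] unfolding matrix_inv_def .
  then show *: "A ** matrix_inv A = mat 1" "matrix_inv A ** A = mat 1"
    by auto
  show "A *v (matrix_inv A *v v) = v" "matrix_inv A *v (A *v v) = v"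
    by (simp_all add: matrix_vector_mul_assoc *)
qed

lemma invertible_matrix_inv: "invertible (matrix_inv A)" if "invertible A"
  for A :: "'k::field ^ 'n ^ 'n"
  using matrix_inv_cancel[OF that] unfolding invertible_def by blast

context ultrametric_local_field begin

lemma std_norm_ge: "absv (v $ i) \<le> std_norm absv v"
  unfolding std_norm_def by (rule Max_ge) auto

lemma std_norm_le_iff: "std_norm absv v \<le> c \<longleftrightarrow> (\<forall>i. absv (v $ i) \<le> c)"
  unfolding std_norm_def by (subst Max_le_iff) auto

lemma std_norm_attained: obtains i where "std_norm absv v = absv (v $ i)"
proof -
  have "std_norm absv v \<in> range (\<lambda>i. absv (v $ i))"
    unfolding std_norm_def by (rule Max_in) auto
  with that show ?thesis by auto
qed

lemma std_norm_vertex: "(std_norm absv :: 'k ^ 'n \<Rightarrow> real) \<in> building_vertices q absv"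
  unfolding building_vertices_iff[OF q_ge_2]
proof (intro conjI allI impI)
  fix u v :: "'k ^ 'n" and a
  show "std_norm absv v \<in> powers q" if v: "v \<noteq> 0"
  proof -
    obtain j where "v $ j \<noteq> 0"
      using v by (metis vec_eq_iff zero_index)
    then have "0 < std_norm absv v"
      using std_norm_ge[of v j] absv_nonneg[of "v $ j"] absv_eq_0_iff[of "v $ j"] by linarith
    moreover obtain i where "std_norm absv v = absv (v $ i)"
      by (rule std_norm_attained)
    ultimately show ?thesis
      using absv_in_powers[of "v $ i"] absv_eq_0_iff[of "v $ i"] by auto
  qed
  show "std_norm absv (0 :: 'k ^ 'n) = 0"
    by (rule std_norm_attained[of "0 :: 'k ^ 'n"]) simp
  show "std_norm absv (a *s v) = absv a * std_norm absv v"
  proof (rule antisym)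
    show "std_norm absv (a *s v) \<le> absv a * std_norm absv v"
      by (auto simp: std_norm_le_iff absv_mult intro: mult_left_mono std_norm_ge absv_nonneg)
    obtain i where "std_norm absv v = absv (v $ i)"
      by (rule std_norm_attained)
    then show "absv a * std_norm absv v \<le> std_norm absv (a *s v)"
      using std_norm_ge[of "a *s v" i] by (simp add: absv_mult)
  qed
  show "std_norm absv (u + v) \<le> max (std_norm absv u) (std_norm absv v)"
    unfolding std_norm_le_iff
  proof
    fix i
    show "absv ((u + v) $ i) \<le> max (std_norm absv u) (std_norm absv v)"
      using absv_ultrametric[of "u $ i" "v $ i"] std_norm_ge[of u i] std_norm_ge[of v i]
      by (simp add: max_def split: if_splits)
  qed
qed

lemma vertex_comp_matrix:
  fixes \<eta> :: "'k ^ 'n \<Rightarrow> real" and A :: "'k ^ 'n ^ 'n"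
  assumes \<eta>: "\<eta> \<in> building_vertices q absv" and "invertible A"
  shows "(\<lambda>v. \<eta> (A *v v)) \<in> building_vertices q absv"
proof -
  have "A *v v \<noteq> 0" if "v \<noteq> 0" for v
    using matrix_inv_cancel(4)[OF assms(2), of v] that by auto
  then show ?thesis
    unfolding building_vertices_iff[OF q_ge_2]
    using vertex_in_powers[OF \<eta>] vertex_add[OF \<eta>]
    by (auto simp: vertex_zero[OF \<eta>] vec.scale vertex_scale[OF \<eta>] matrix_vector_right_distrib)
qed

text \<open>The columns of \<open>A\<close> are an orthonormal basis, so \<open>A *v v\<close> is
  the combination with coefficients \<open>v\<close>. A kernel vector would have standard norm 0,
  hence \<open>A\<close> is invertible.\<close>

lemma vertex_eq_std_norm:
  fixes \<eta> :: "'k ^ 'n \<Rightarrow> real"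
  assumes \<eta>: "\<eta> \<in> building_vertices q absv"
  obtains A :: "'k ^ 'n ^ 'n" where "invertible A" "\<And>v. \<eta> (A *v v) = std_norm absv v"
proof -
  obtain b :: "'n \<Rightarrow> 'k ^ 'n" where b: "orthonormal absv \<eta> b UNIV"
    using ex_orthonormal[OF \<eta>, of UNIV] by blast
  define A :: "'k ^ 'n ^ 'n" where "A = (\<chi> i j. b j $ i)"
  have eq: "\<eta> (A *v v) = std_norm absv v" for v
  proof -
    have "column j A = b j" for j
      by (simp add: A_def column_def vec_eq_iff)
    then have "\<eta> (A *v v) = Max (insert 0 (range (\<lambda>j. absv (v $ j))))"
      using b unfolding orthonormal_def by (simp add: matrix_mult_sum)
    also have "\<dots> = std_norm absv v"
      using vertex_nonneg[OF std_norm_vertex, of v] by (simp add: std_norm_def)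
    finally show ?thesis .
  qed
  have "v = 0" if "A *v v = 0" for v
    using eq[of v] that vertex_eq_0_iff[OF std_norm_vertex, of v] vertex_zero[OF \<eta>] by simp
  then have "invertible A"
    using invertible_left_inverse matrix_left_invertible_ker by blast
  with eq that show ?thesis by blast
qed

lemma vertex_le_std_norm:
  fixes \<eta> :: "'k ^ 'n \<Rightarrow> real"
  assumes \<eta>: "\<eta> \<in> building_vertices q absv"
  obtains m where "\<And>v. \<eta> v \<le> real q ^ m * std_norm absv v"
proof -
  \<comment> \<open>The constant bounds the norms of the unit vectors; expanding \<open>v\<close> in
    them does the rest.\<close>
  obtain m where m: "Max (range (\<lambda>i. \<eta> (axis i 1))) \<le> real q ^ m"
    using power_unbounded[OF q_ge_2] by blast
  have "\<eta> v \<le> real q ^ m * std_norm absv v" for v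
  proof -
    have "\<eta> (v $ i *s axis i 1) \<le> real q ^ m * std_norm absv v" for i
    proof -
      have "\<eta> (axis i 1) \<le> real q ^ m"
        using m by (subst (asm) Max_le_iff) auto
      then show ?thesis
        using mult_mono[of "\<eta> (axis i 1)" "real q ^ m" "absv (v $ i)" "std_norm absv v"]
          std_norm_ge[of v i] absv_nonneg by (simp add: vertex_scale[OF \<eta>] mult.commute)
    qed
    then have "\<eta> (\<Sum>i\<in>UNIV. v $ i *s axis i 1) \<le> real q ^ m * std_norm absv v"
      using vertex_nonneg[OF std_norm_vertex, of v] by (intro vertex_sum_le[OF \<eta>]) auto
    then show ?thesis
      by (simp add: basis_expansion)
  qed
  with that show ?thesis by blast
qed

text \<open>A change of basis makes \<open>\<eta>'\<close> the standard norm, for which the estimate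
  follows from the unit vectors; substituting \<open>matrix_inv A *v v\<close> undoes the change.
  Two such estimates are combined by taking the larger exponent.\<close>

lemma ex_norm_close:
  fixes \<eta> \<eta>' :: "'k ^ 'n \<Rightarrow> real"
  assumes "\<eta> \<in> building_vertices q absv" "\<eta>' \<in> building_vertices q absv"
  obtains m where "norm_close q m \<eta> \<eta>'"
proof -
  have *: "\<exists>m. \<forall>v. \<eta> v \<le> real q ^ m * \<eta>' v"
    if \<eta>: "\<eta> \<in> building_vertices q absv" and \<eta>': "\<eta>' \<in> building_vertices q absv"
    for \<eta> \<eta>' :: "'k ^ 'n \<Rightarrow> real"
  proof -
    obtain A :: "'k ^ 'n ^ 'n" where A: "invertible A" "\<And>v. \<eta>' (A *v v) = std_norm absv v"
      using vertex_eq_std_norm[OF \<eta>'] by blast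
    obtain m where "\<And>v. \<eta> (A *v v) \<le> real q ^ m * std_norm absv v"
      using vertex_le_std_norm[OF vertex_comp_matrix[OF \<eta> A(1)]] by blast
    then have "\<eta> (A *v (matrix_inv A *v v)) \<le> real q ^ m * \<eta>' (A *v (matrix_inv A *v v))" for v
      unfolding A(2) by blast
    then show ?thesis
      unfolding matrix_inv_cancel[OF A(1)] by blast
  qed
  obtain m n where mn: "\<And>v. \<eta> v \<le> real q ^ m * \<eta>' v" "\<And>v. \<eta>' v \<le> real q ^ n * \<eta> v"
    using *[OF assms] *[OF assms(2,1)] by blast
  have "real q ^ m * \<eta>' v \<le> real q ^ max m n * \<eta>' v" "real q ^ n * \<eta> v \<le> real q ^ max m n * \<eta> v" for v
    using q_pos vertex_nonneg[OF assms(1), of v] vertex_nonneg[OF assms(2), of v]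
    by (auto intro!: mult_right_mono power_increasing)
  then have "norm_close q (max m n) \<eta> \<eta>'"
    unfolding norm_close_def using mn order_trans by blast
  with that show ?thesis .
qed

lemma abs_log_le_iff: "\<bar>log (real q) (a / b)\<bar> \<le> real m \<longleftrightarrow> a \<le> real q ^ m * b \<and> b \<le> real q ^ m * a"
  if "a > 0" "b > 0"
proof -
  have "\<bar>log (real q) (a / b)\<bar> \<le> real m \<longleftrightarrow>
      log (real q) a \<le> log (real q) (real q ^ m * b) \<and> log (real q) b \<le> log (real q) (real q ^ m * a)"
    using that q_pos by (auto simp: log_divide log_mult log_nat_power)
  also have "\<dots> \<longleftrightarrow> a \<le> real q ^ m * b \<and> b \<le> real q ^ m * a"
    using that q_pos by simp
  finally show ?thesis .
qed

text \<open>A real supremum is only meaningful for a nonempty, bounded set: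
  \<open>ex_norm_close\<close> supplies the bound, and a unit vector the nonemptiness.\<close>

lemma building_dist_le_iff:
  fixes \<eta> \<eta>' :: "'k ^ 'n \<Rightarrow> real"
  assumes \<eta>: "\<eta> \<in> building_vertices q absv" and \<eta>': "\<eta>' \<in> building_vertices q absv"
  shows "building_dist q \<eta> \<eta>' \<le> real m \<longleftrightarrow> norm_close q m \<eta> \<eta>'"
    and "v \<noteq> 0 \<Longrightarrow> \<bar>log (real q) (\<eta> v / \<eta>' v)\<bar> \<le> building_dist q \<eta> \<eta>'"
proof -
  have close_iff: "norm_close q m \<eta> \<eta>' \<longleftrightarrow> (\<forall>v\<in>UNIV - {0}. \<bar>log (real q) (\<eta> v / \<eta>' v)\<bar> \<le> real m)" for m
  proof -
    have "\<bar>log (real q) (\<eta> v / \<eta>' v)\<bar> \<le> real m \<longleftrightarrow> \<eta> v \<le> real q ^ m * \<eta>' v \<and> \<eta>' v \<le> real q ^ m * \<eta> v"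
      if "v \<noteq> 0" for v
      using vertex_pos[OF \<eta> that] vertex_pos[OF \<eta>' that] by (rule abs_log_le_iff)
    then show ?thesis
      unfolding norm_close_def using vertex_zero[OF \<eta>] vertex_zero[OF \<eta>']
      by (metis DiffD2 DiffI UNIV_I insertI1 mult_zero_right order_refl singletonD)
  qed
  obtain n where "norm_close q n \<eta> \<eta>'"
    using ex_norm_close[OF \<eta> \<eta>'] .
  then have bdd: "bdd_above ((\<lambda>v. \<bar>log (real q) (\<eta> v / \<eta>' v)\<bar>) ` (UNIV - {0}))"
    unfolding close_iff by (auto intro: bdd_aboveI2)
  have "axis undefined 1 \<in> UNIV - {0 :: 'k ^ 'n}"
    by (simp add: axis_eq_0_iff)
  then have "UNIV - {0 :: 'k ^ 'n} \<noteq> {}"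
    by blast
  then show "building_dist q \<eta> \<eta>' \<le> real m \<longleftrightarrow> norm_close q m \<eta> \<eta>'"
    unfolding close_iff building_dist_def by (rule cSUP_le_iff[OF _ bdd])
  show "\<bar>log (real q) (\<eta> v / \<eta>' v)\<bar> \<le> building_dist q \<eta> \<eta>'" if "v \<noteq> 0"
    unfolding building_dist_def using that by (intro cSUP_upper bdd) auto
qed

text \<open>At a vector where two distinct norms disagree, discreteness makes them differ by a
  factor of at least \<open>q\<close>, which rules out distances strictly between 0 and 1.\<close>

lemma building_dist_eq_1_iff:
  fixes \<eta> \<eta>' :: "'k ^ 'n \<Rightarrow> real"
  assumes \<eta>: "\<eta> \<in> building_vertices q absv" and \<eta>': "\<eta>' \<in> building_vertices q absv"
  shows "building_dist q \<eta> \<eta>' = 1 \<longleftrightarrow> norm_close q 1 \<eta> \<eta>' \<and> \<eta> \<noteq> \<eta>'"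
proof
  assume *: "building_dist q \<eta> \<eta>' = 1"
  then have "\<not> norm_close q 0 \<eta> \<eta>'"
    using building_dist_le_iff(1)[OF \<eta> \<eta>', of 0] by simp
  then show "norm_close q 1 \<eta> \<eta>' \<and> \<eta> \<noteq> \<eta>'"
    using building_dist_le_iff(1)[OF \<eta> \<eta>', of 1] * by (simp add: norm_close_0_iff)
next
  assume *: "norm_close q 1 \<eta> \<eta>' \<and> \<eta> \<noteq> \<eta>'"
  then have le: "building_dist q \<eta> \<eta>' \<le> 1"
    using building_dist_le_iff(1)[OF \<eta> \<eta>', of 1] by simp
  obtain v where v: "\<eta> v \<noteq> \<eta>' v"
    using * by auto
  then have "v \<noteq> 0"
    using vertex_zero[OF \<eta>] vertex_zero[OF \<eta>'] by auto
  note pos = vertex_pos[OF \<eta> this] vertex_pos[OF \<eta>' this]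
  have "q * \<eta> v \<le> \<eta>' v \<or> q * \<eta>' v \<le> \<eta> v"
    using v powers_gap[OF _ _ _ q_ge_2] vertex_in_powers[OF \<eta> \<open>v \<noteq> 0\<close>] vertex_in_powers[OF \<eta>' \<open>v \<noteq> 0\<close>]
    by (meson linorder_neqE_linordered_idom)
  then have "log q (q * \<eta> v) \<le> log q (\<eta>' v) \<or> log q (q * \<eta>' v) \<le> log q (\<eta> v)"
    using pos q_pos by simp
  then have "1 \<le> \<bar>log (real q) (\<eta> v / \<eta>' v)\<bar>"
    using pos q_pos by (auto simp: log_mult log_divide)
  also have "\<dots> \<le> building_dist q \<eta> \<eta>'"
    by (rule building_dist_le_iff(2)[OF \<eta> \<eta>' \<open>v \<noteq> 0\<close>])
  finally show "building_dist q \<eta> \<eta>' = 1"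
    using le by simp
qed

section \<open>Suprema of norms and the Helly property of order intervals\<close>

lemma vertex_scaled:
  fixes \<eta> :: "'k ^ 'n \<Rightarrow> real"
  assumes \<eta>: "\<eta> \<in> building_vertices q absv" and c: "c \<in> powers q"
  shows "(\<lambda>v. c * \<eta> v) \<in> building_vertices q absv"
proof -
  have "c > 0"
    using c powers_pos q_ge_2 by blast
  then have "max (c * \<eta> u) (c * \<eta> v) = c * max (\<eta> u) (\<eta> v)" for u v
    by (simp add: max_mult_distrib_left)
  with \<open>c > 0\<close> show ?thesis
    unfolding building_vertices_iff[OF q_ge_2]
    using vertex_in_powers[OF \<eta>] vertex_add[OF \<eta>] powers_mult[OF c _ q_ge_2]
    by (auto simp: vertex_zero[OF \<eta>] vertex_scale[OF \<eta>] mult_left_mono)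
qed

text \<open>Discreteness makes the supremum at each \<open>v\<close> an attained maximum, so its
  values remain powers of \<open>q\<close>. The member \<open>M v\<close> attaining it varies with
  \<open>v\<close>. Attainment is also exported, since upper bounds in the Helly argument are
  checked on a single member.\<close>

lemma vertex_sup:
  fixes F :: "('k ^ 'n \<Rightarrow> real) set"
  assumes F: "F \<subseteq> building_vertices q absv" "F \<noteq> {}" and B: "\<And>\<eta> v. \<eta> \<in> F \<Longrightarrow> \<eta> v \<le> B v"
  obtains \<zeta> where "\<zeta> \<in> building_vertices q absv" "\<And>\<eta> v. \<eta> \<in> F \<Longrightarrow> \<eta> v \<le> \<zeta> v"
    "\<And>v. \<exists>\<eta>\<in>F. \<zeta> v = \<eta> v"
proof -
  have "\<exists>\<eta>\<in>F. \<forall>\<eta>'\<in>F. \<eta>' v \<le> \<eta> v" for v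
  proof (cases "v = 0")
    case True
    then show ?thesis
      using F vertex_zero by fastforce
  next
    case False
    have "\<exists>a\<in>(\<lambda>\<eta>. \<eta> v) ` F. \<forall>b\<in>(\<lambda>\<eta>. \<eta> v) ` F. b \<le> a"
    proof (rule powers_max[OF _ _ q_ge_2])
      show "(\<lambda>\<eta>. \<eta> v) ` F \<subseteq> powers q"
        using F False vertex_in_powers by blast
      show "a \<le> B v" if "a \<in> (\<lambda>\<eta>. \<eta> v) ` F" for a
        using that B by auto
    qed (use F in auto)
    then show ?thesis by auto
  qed
  then obtain M where M: "\<And>v. M v \<in> F" "\<And>v \<eta>. \<eta> \<in> F \<Longrightarrow> \<eta> v \<le> M v v"
    by metis
  have vM: "M v \<in> building_vertices q absv" for v
    using M(1) F by blast
  have "(\<lambda>v. M v v) \<in> building_vertices q absv"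
    unfolding building_vertices_iff[OF q_ge_2]
  proof (intro conjI allI impI)
    fix u v :: "'k ^ 'n" and a
    show "M v v \<in> powers q" if "v \<noteq> 0"
      using vertex_in_powers[OF vM that] .
    show "M 0 0 = 0"
      by (rule vertex_zero[OF vM])
    \<comment> \<open>The maximisers at \<open>v\<close> and at \<open>a *s v\<close> may differ;
      each is compared with the other at the vector where the other is maximal.\<close>
    show "M (a *s v) (a *s v) = absv a * M v v"
    proof (rule antisym)
      show "M (a *s v) (a *s v) \<le> absv a * M v v"
        using M absv_nonneg by (simp add: vertex_scale[OF vM] mult_left_mono)
      have "absv a * M v v = M v (a *s v)"
        by (simp add: vertex_scale[OF vM])
      then show "absv a * M v v \<le> M (a *s v) (a *s v)"
        using M by simp
    qed
    show "M (u + v) (u + v) \<le> max (M u u) (M v v)"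
      using vertex_add[OF vM, of "u + v" u v] M(2)[OF M(1)[of "u + v"], of u]
        M(2)[OF M(1)[of "u + v"], of v]
      by (simp add: max_def split: if_splits)
  qed
  then show ?thesis
    using M that[of "\<lambda>v. M v v"] by blast
qed

text \<open>The elements of \<open>I\<close> are pairs of a centre and a radius. The input is a
  bound on distances of centres rather than a common point of two balls; this lets the lemma also
  produce intermediate points and intersections of two given balls.\<close>

lemma norm_close_helly:
  fixes I :: "(('k ^ 'n \<Rightarrow> real) \<times> nat) set"
  assumes "fst ` I \<subseteq> building_vertices q absv"
    and close: "\<And>\<eta> \<eta>' r r'. (\<eta>, r) \<in> I \<Longrightarrow> (\<eta>', r') \<in> I \<Longrightarrow> norm_close q (r + r') \<eta> \<eta>'"
  obtains \<zeta> where "\<zeta> \<in> building_vertices q absv" "\<And>\<eta> r. (\<eta>, r) \<in> I \<Longrightarrow> norm_close q r \<eta> \<zeta>"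
proof (cases "I = {}")
  case True
  then show ?thesis
    using that[OF std_norm_vertex] by simp
next
  case False
  then obtain \<eta>0 r0 where 0: "(\<eta>0, r0) \<in> I" by auto
  define F where "F = (\<lambda>(\<eta>, r) v. inverse (real q ^ r) * \<eta> v) ` I"
  have le: "inverse (real q ^ r) * \<eta> v \<le> real q ^ r' * \<eta>' v" if "(\<eta>, r) \<in> I" "(\<eta>', r') \<in> I" for \<eta> r \<eta>' r' v
  proof -
    have "\<eta> v \<le> real q ^ (r + r') * \<eta>' v"
      using close[OF that] by (simp add: norm_close_def)
    then show ?thesis
      using q_pos by (simp add: power_add field_simps)
  qed
  have "F \<subseteq> building_vertices q absv"
    using assms(1) vertex_scaled[OF _ powers_inverse[OF power_in_powers q_ge_2]] by (force simp: F_def)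
  moreover have "F \<noteq> {}"
    using False by (simp add: F_def)
  \<comment> \<open>The upper end of any one interval bounds all lower ends, whatever the size of
    the family.\<close>
  moreover have "\<eta> v \<le> real q ^ r0 * \<eta>0 v" if "\<eta> \<in> F" for \<eta> v
    using that le[OF _ 0] by (auto simp: F_def)
  ultimately obtain \<zeta> where \<zeta>: "\<zeta> \<in> building_vertices q absv" "\<And>\<eta> v. \<eta> \<in> F \<Longrightarrow> \<eta> v \<le> \<zeta> v"
    "\<And>v. \<exists>\<eta>\<in>F. \<zeta> v = \<eta> v"
    by (rule vertex_sup) auto
  have "norm_close q r \<eta> \<zeta>" if "(\<eta>, r) \<in> I" for \<eta> r
    unfolding norm_close_def
  proof (intro allI conjI)
    fix v
    have "inverse (real q ^ r) * \<eta> v \<le> \<zeta> v"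
      using \<zeta>(2)[of "\<lambda>v. inverse (real q ^ r) * \<eta> v" v] that by (force simp: F_def)
    then show "\<eta> v \<le> real q ^ r * \<zeta> v"
      using q_pos by (simp add: field_simps)
    show "\<zeta> v \<le> real q ^ r * \<eta> v"
      using \<zeta>(3)[of v] le[OF _ that] by (auto simp: F_def)
  qed
  with \<zeta>(1) that show ?thesis by blast
qed

lemma norm_close_mono: "norm_close q m \<eta> \<eta>' \<Longrightarrow> m \<le> n \<Longrightarrow> norm_close q n \<eta> \<eta>'"
  if "\<eta> \<in> building_vertices q absv" "\<eta>' \<in> building_vertices q absv" for \<eta> \<eta>' :: "'k ^ 'n \<Rightarrow> real"
proof -
  assume *: "norm_close q m \<eta> \<eta>'" "m \<le> n"
  have "real q ^ m * \<eta> v \<le> real q ^ n * \<eta> v" "real q ^ m * \<eta>' v \<le> real q ^ n * \<eta>' v" for v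
    using q_pos * vertex_nonneg[OF that(1)] vertex_nonneg[OF that(2)]
    by (auto intro!: mult_right_mono power_increasing)
  then show ?thesis
    using * unfolding norm_close_def by (meson order_trans)
qed

lemma norm_close_Suc:
  fixes \<eta> \<eta>' :: "'k ^ 'n \<Rightarrow> real"
  assumes "\<eta> \<in> building_vertices q absv" "\<eta>' \<in> building_vertices q absv" "norm_close q (Suc m) \<eta> \<eta>'"
  obtains \<zeta> where "\<zeta> \<in> building_vertices q absv" "norm_close q 1 \<eta> \<zeta>" "norm_close q m \<zeta> \<eta>'"
proof -
  \<comment> \<open>The family below is also paired with itself, so closeness on the diagonal is
    required for arbitrary exponents.\<close>
  have refl: "norm_close q n \<xi> \<xi>" if "\<xi> \<in> building_vertices q absv" for n and \<xi> :: "'k ^ 'n \<Rightarrow> real"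
    by (rule norm_close_mono[OF that that, of 0]) (simp_all add: norm_close_0_iff)
  define I where "I = {(\<eta>, 1), (\<eta>', m)}"
  have "fst ` I \<subseteq> building_vertices q absv"
    using assms by (simp add: I_def)
  moreover have "norm_close q (r + r') \<xi> \<xi>'" if "(\<xi>, r) \<in> I" "(\<xi>', r') \<in> I" for \<xi> \<xi>' r r'
    using that assms norm_close_sym[of q "Suc m" \<eta> \<eta>'] refl by (auto simp: I_def)
  ultimately obtain \<zeta> where \<zeta>: "\<zeta> \<in> building_vertices q absv"
    "\<And>\<xi> r. (\<xi>, r) \<in> I \<Longrightarrow> norm_close q r \<xi> \<zeta>"
    by (rule norm_close_helly) auto
  show ?thesis
    using that[OF \<zeta>(1)] \<zeta>(2)[of \<eta> 1] \<zeta>(2)[of \<eta>' m] norm_close_sym by (auto simp: I_def)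
qed

end

section \<open>The Helly property\<close>

context ultrametric_local_field begin

lemma pverts_thickening [simp]: "pverts (thickening q absv) = building_vertices q absv"
  by (simp add: thickening_def)

lemma parcs_thickening_iff:
  "(\<eta>, \<eta>') \<in> parcs (thickening q absv) \<longleftrightarrow>
     \<eta> \<in> building_vertices q absv \<and> \<eta>' \<in> building_vertices q absv \<and> norm_close q 1 \<eta> \<eta>' \<and> \<eta> \<noteq> \<eta>'"
  using building_dist_eq_1_iff by (auto simp: thickening_def)

lemma pair_bidirected_thickening: "pair_bidirected_digraph (thickening q absv :: ('k ^ 'n \<Rightarrow> real) pair_pre_digraph)"
proof unfold_locales
  fix e :: "('k ^ 'n \<Rightarrow> real) \<times> ('k ^ 'n \<Rightarrow> real)"
  assume "e \<in> parcs (thickening q absv)"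
  then show "fst e \<in> pverts (thickening q absv)" "snd e \<in> pverts (thickening q absv)" "fst e \<noteq> snd e"
    by (metis parcs_thickening_iff pverts_thickening prod.collapse)+
next
  show "symmetric (with_proj (thickening q absv :: ('k ^ 'n \<Rightarrow> real) pair_pre_digraph))"
    unfolding symmetric_def with_proj_simps
    by (rule symI) (use norm_close_sym in \<open>auto simp: parcs_thickening_iff\<close>)
qed

lemma wf_digraph_thickening: "wf_digraph (with_proj (thickening q absv :: ('k ^ 'n \<Rightarrow> real) pair_pre_digraph))"
  using pair_bidirected_thickening[where 'n = 'n]
  by (simp add: wf_digraph_wp_iff pair_bidirected_digraph_def pair_loopfree_digraph_def)

lemma awalk_imp_norm_close:
  assumes "pre_digraph.awalk (with_proj (thickening q absv)) \<eta> p \<eta>'"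
  shows "norm_close q (length p) \<eta> \<eta>'"
proof -
  interpret wf_digraph "with_proj (thickening q absv :: ('k ^ 'n \<Rightarrow> real) pair_pre_digraph)"
    by (rule wf_digraph_thickening)
  show ?thesis
    using assms
  proof (induction p arbitrary: \<eta>)
    case Nil
    then show ?case by (simp add: awalk_Nil_iff norm_close_0_iff)
  next
    case (Cons e p)
    then have "(\<eta>, snd e) \<in> parcs (thickening q absv)" "awalk (snd e) p \<eta>'"
      by (auto simp: awalk_Cons_iff)
    then have "norm_close q (1 + length p) \<eta> \<eta>'"
      by (intro norm_close_trans[OF _ Cons.IH]) (simp_all add: parcs_thickening_iff)
    then show ?case by simp
  qed
qed

lemma norm_close_imp_awalk:
  fixes \<eta> \<eta>' :: "'k ^ 'n \<Rightarrow> real"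
  assumes "\<eta> \<in> building_vertices q absv" "\<eta>' \<in> building_vertices q absv" "norm_close q m \<eta> \<eta>'"
  shows "\<exists>p. pre_digraph.awalk (with_proj (thickening q absv)) \<eta> p \<eta>' \<and> length p \<le> m"
proof -
  interpret wf_digraph "with_proj (thickening q absv :: ('k ^ 'n \<Rightarrow> real) pair_pre_digraph)"
    by (rule wf_digraph_thickening)
  show ?thesis
    using assms
  proof (induction m arbitrary: \<eta>)
    case 0
    then show ?case by (auto simp: awalk_Nil_iff norm_close_0_iff)
  next
    case (Suc m)
    then obtain \<zeta> where \<zeta>: "\<zeta> \<in> building_vertices q absv" "norm_close q 1 \<eta> \<zeta>" "norm_close q m \<zeta> \<eta>'"
      by (blast elim: norm_close_Suc)
    then obtain p where p: "awalk \<zeta> p \<eta>'" "length p \<le> m"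
      using Suc by blast
    \<comment> \<open>The intermediate norm may coincide with \<open>\<eta>\<close>. The graph has
      no loops, so that step is dropped, and the walk has length at most \<open>m\<close> rather
      than exactly \<open>m\<close>.\<close>
    show ?case
    proof (cases "\<zeta> = \<eta>")
      case True
      with p show ?thesis by (auto intro!: exI[of _ p])
    next
      case False
      with p \<zeta> Suc.prems show ?thesis
        by (intro exI[of _ "(\<eta>, \<zeta>) # p"]) (auto simp: awalk_Cons_iff parcs_thickening_iff)
    qed
  qed
qed

lemma combinatorial_ball_eq:
  fixes \<eta> :: "'k ^ 'n \<Rightarrow> real"
  assumes \<eta>: "\<eta> \<in> building_vertices q absv"
  shows "combinatorial_ball (thickening q absv) \<eta> r = {\<zeta> \<in> building_vertices q absv. norm_close q r \<eta> \<zeta>}"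
proof -
  interpret wf_digraph "with_proj (thickening q absv :: ('k ^ 'n \<Rightarrow> real) pair_pre_digraph)"
    by (rule wf_digraph_thickening)
  have cost: "awalk_cost (\<lambda>_. 1) p = real (length p)" for p :: "(('k ^ 'n \<Rightarrow> real) \<times> ('k ^ 'n \<Rightarrow> real)) list"
    by (induction p) auto
  have "\<mu> (\<lambda>_. 1) \<eta> \<zeta> \<le> ereal (real r) \<longleftrightarrow> norm_close q r \<eta> \<zeta>"
    if \<zeta>: "\<zeta> \<in> building_vertices q absv" for \<zeta>
  proof
    assume "\<mu> (\<lambda>_. 1) \<eta> \<zeta> \<le> ereal (real r)"
    \<comment> \<open>A strict bound is needed to extract a walk from the infimum; lengths are
      integers, so below \<open>Suc r\<close> means at most \<open>r\<close>.\<close>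
    also have "\<dots> < ereal (real (Suc r))"
      by simp
    finally obtain p where p: "awalk \<eta> p \<zeta>" "length p < Suc r"
      unfolding \<mu>_def INF_less_iff cost by auto
    then show "norm_close q r \<eta> \<zeta>"
      using norm_close_mono[OF \<eta> \<zeta> awalk_imp_norm_close] by auto
  next
    assume "norm_close q r \<eta> \<zeta>"
    then obtain p where p: "awalk \<eta> p \<zeta>" "length p \<le> r"
      using norm_close_imp_awalk[OF \<eta> \<zeta>] by blast
    have "\<mu> (\<lambda>_. 1) \<eta> \<zeta> \<le> ereal (real (length p))"
      using min_cost_le_walk_cost[OF p(1), of "\<lambda>_. 1"] by (simp add: cost)
    also have "\<dots> \<le> ereal (real r)"
      using p by simp
    finally show "\<mu> (\<lambda>_. 1) \<eta> \<zeta> \<le> ereal (real r)" .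
  qed
  then show ?thesis
    unfolding combinatorial_ball_def by auto
qed

lemma connected_thickening:
  "Digraph_Component.connected (with_proj (thickening q absv :: ('k ^ 'n \<Rightarrow> real) pair_pre_digraph))"
proof -
  interpret wf_digraph "with_proj (thickening q absv :: ('k ^ 'n \<Rightarrow> real) pair_pre_digraph)"
    by (rule wf_digraph_thickening)
  have "strongly_connected (mk_symmetric (with_proj (thickening q absv :: ('k ^ 'n \<Rightarrow> real) pair_pre_digraph)))"
  proof (rule strongly_connectedI)
    show "verts (mk_symmetric (with_proj (thickening q absv :: ('k ^ 'n \<Rightarrow> real) pair_pre_digraph))) \<noteq> {}"
      using std_norm_vertex by auto
    fix \<eta> \<eta>' :: "'k ^ 'n \<Rightarrow> real"
    assume "\<eta> \<in> verts (mk_symmetric (with_proj (thickening q absv)))"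
      and "\<eta>' \<in> verts (mk_symmetric (with_proj (thickening q absv)))"
    then have \<eta>: "\<eta> \<in> building_vertices q absv" "\<eta>' \<in> building_vertices q absv"
      by auto
    obtain m where "norm_close q m \<eta> \<eta>'"
      using ex_norm_close[OF \<eta>] .
    then have "\<eta> \<rightarrow>\<^sup>*\<^bsub>with_proj (thickening q absv)\<^esub> \<eta>'"
      using norm_close_imp_awalk[OF \<eta>] reachable_awalk by blast
    then show "\<eta> \<rightarrow>\<^sup>*\<^bsub>mk_symmetric (with_proj (thickening q absv))\<^esub> \<eta>'"
      by (rule reachable_mk_symmetricI)
  qed
  then show ?thesis
    unfolding connected_def .
qed

theorem helly_thickening: "helly_graph (thickening q absv :: ('k ^ 'n \<Rightarrow> real) pair_pre_digraph)"
  unfolding helly_graph_def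
proof (intro conjI allI impI)
  let ?\<Gamma> = "thickening q absv :: ('k ^ 'n \<Rightarrow> real) pair_pre_digraph"
  fix \<B>
  assume \<B>: "\<B> \<subseteq> {combinatorial_ball ?\<Gamma> x r |x r. x \<in> pverts ?\<Gamma>}"
    and inter: "\<forall>B\<in>\<B>. \<forall>C\<in>\<B>. B \<inter> C \<noteq> {}"
  define I where "I = {(\<eta>, r). \<eta> \<in> building_vertices q absv \<and> combinatorial_ball ?\<Gamma> \<eta> r \<in> \<B>}"
  have "fst ` I \<subseteq> building_vertices q absv"
    by (auto simp: I_def)
  moreover have "norm_close q (r + r') \<eta> \<eta>'" if I: "(\<eta>, r) \<in> I" "(\<eta>', r') \<in> I" for \<eta> r \<eta>' r'
  proof -
    have "combinatorial_ball ?\<Gamma> \<eta> r \<inter> combinatorial_ball ?\<Gamma> \<eta>' r' \<noteq> {}"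
      using inter I by (auto simp: I_def)
    then obtain \<zeta> where "norm_close q r \<eta> \<zeta>" "norm_close q r' \<eta>' \<zeta>"
      using I by (auto simp: I_def combinatorial_ball_eq)
    then show ?thesis
      using norm_close_trans norm_close_sym by metis
  qed
  ultimately obtain \<zeta> where \<zeta>: "\<zeta> \<in> building_vertices q absv"
    "\<And>\<eta> r. (\<eta>, r) \<in> I \<Longrightarrow> norm_close q r \<eta> \<zeta>"
    by (rule norm_close_helly) auto
  have "\<zeta> \<in> B" if B: "B \<in> \<B>" for B
  proof -
    obtain \<eta> r where "\<eta> \<in> building_vertices q absv" "B = combinatorial_ball ?\<Gamma> \<eta> r"
      using \<B> B by auto
    with B \<zeta> show ?thesis
      by (auto simp: I_def combinatorial_ball_eq)
  qed
  with \<zeta>(1) show "pverts ?\<Gamma> \<inter> \<Inter>\<B> \<noteq> {}"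
    by auto
qed (rule pair_bidirected_thickening connected_thickening)+

end

section \<open>Compactness\<close>

lemma finite_vec_components: "finite {v :: 'a ^ 'n. \<forall>i. v $ i \<in> F}" if "finite F"
proof -
  have "{v :: 'a ^ 'n. \<forall>i. v $ i \<in> F} \<subseteq> vec_lambda ` (UNIV \<rightarrow>\<^sub>E F)"
    by (auto intro!: image_eqI[of v vec_lambda "vec_nth v" for v])
  moreover have "finite (vec_lambda ` (UNIV \<rightarrow>\<^sub>E F) :: ('a ^ 'n) set)"
    using that by (intro finite_imageI finite_PiE) auto
  ultimately show ?thesis
    by (rule finite_subset)
qed

text \<open>Total boundedness asks for centres inside \<open>S\<close>. A net at scale
  \<open>\<epsilon> / 2\<close> with arbitrary centres suffices: each ball that meets
  \<open>S\<close> is recentred at a point of \<open>S\<close>, at the cost of doubling the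
  radius.\<close>

lemma (in Metric_space) mtotally_bounded_if_finite_nets:
  assumes "S \<subseteq> M" and nets: "\<And>\<epsilon>. \<epsilon> > 0 \<Longrightarrow> \<exists>F. finite F \<and> F \<subseteq> M \<and> S \<subseteq> (\<Union>x\<in>F. mball x \<epsilon>)"
  shows "mtotally_bounded S"
  unfolding mtotally_bounded_def
proof (intro allI impI)
  fix \<epsilon> :: real
  assume "\<epsilon> > 0"
  then obtain F where F: "finite F" "F \<subseteq> M" "S \<subseteq> (\<Union>x\<in>F. mball x (\<epsilon> / 2))"
    using nets[of "\<epsilon> / 2"] by auto
  define F' where "F' = {x \<in> F. S \<inter> mball x (\<epsilon> / 2) \<noteq> {}}"
  have "\<forall>x\<in>F'. \<exists>y. y \<in> S \<and> y \<in> mball x (\<epsilon> / 2)"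
    by (auto simp: F'_def)
  then obtain c where c: "\<And>x. x \<in> F' \<Longrightarrow> c x \<in> S \<and> c x \<in> mball x (\<epsilon> / 2)"
    by metis
  have "S \<subseteq> (\<Union>x\<in>c ` F'. mball x \<epsilon>)"
  proof
    fix s assume s: "s \<in> S"
    then obtain x where "x \<in> F" "s \<in> mball x (\<epsilon> / 2)"
      using F(3) by blast
    with s have x: "x \<in> F'" "s \<in> mball x (\<epsilon> / 2)"
      unfolding F'_def by blast+
    then have "s \<in> mball (c x) \<epsilon>"
      using c[of x] triangle[of "c x" x s] by (auto simp: commute)
    with x show "s \<in> (\<Union>x\<in>c ` F'. mball x \<epsilon>)"
      by blast
  qed
  moreover have "finite (c ` F')" "c ` F' \<subseteq> S"
    using F(1) c by (auto simp: F'_def)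
  ultimately show "\<exists>K. finite K \<and> K \<subseteq> S \<and> S \<subseteq> (\<Union>x\<in>K. mball x \<epsilon>)"
    by blast
qed

section \<open>Finite nets of scalars, vectors and matrices\<close>

context ultrametric_local_field begin

text \<open>One representative per residue class forms the net. Congruence means
  \<open>absv (x - f) < 1\<close>, and the gap in the value set improves this to
  \<open>inverse q\<close>.\<close>

lemma finite_residue_net:
  obtains F where "finite F" "\<And>x. absv x \<le> 1 \<Longrightarrow> \<exists>f\<in>F. absv (x - f) \<le> inverse q"
proof -
  define R where "R = {(x, y). x \<in> valuation_ring absv \<and> y \<in> valuation_ring absv \<and> absv (x - y) < 1}"
  have "finite ((\<lambda>C. SOME y. y \<in> C) ` residue_field absv)"
    using finite_residue_field by simp
  moreover have "\<exists>f\<in>(\<lambda>C. SOME y. y \<in> C) ` residue_field absv. absv (x - f) \<le> inverse q"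
    if x: "absv x \<le> 1" for x
  proof -
    define f where "f = (SOME y. y \<in> R `` {x})"
    have "x \<in> R `` {x}"
      using x by (simp add: R_def valuation_ring_def)
    then have "f \<in> R `` {x}"
      unfolding f_def by (rule someI)
    then have less: "absv (x - f) < 1"
      by (simp add: R_def)
    have "absv (x - f) \<le> inverse q"
    proof (cases "x = f")
      case False
      then have "q * absv (x - f) \<le> 1"
        using powers_gap[OF absv_in_powers _ less q_ge_2] power_in_powers[of q 0] by simp
      then show ?thesis
        using q_pos by (simp add: field_simps)
    qed simp
    moreover have "R `` {x} \<in> residue_field absv"
      using x by (auto simp: residue_field_def R_def quotient_def valuation_ring_def)
    ultimately show ?thesis
      unfolding f_def by blast
  qed
  ultimately show ?thesis
    using that by blast
qed

text \<open>Truncated digit expansions: in each step the remaining error is rescaled into the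
  valuation ring by \<open>a\<close>, and a residue representative supplies the next digit, gaining
  a factor \<open>q\<close>.\<close>

lemma finite_net_scaled:
  assumes c: "c \<in> powers q"
  shows "\<exists>F. finite F \<and> (\<forall>x. absv x \<le> c \<longrightarrow> (\<exists>f\<in>F. absv (x - f) \<le> c * inverse (real q ^ n)))"
proof (induction n)
  case 0
  show ?case
    by (intro exI[of _ "{0}"]) simp
next
  case (Suc n)
  then obtain F where F: "finite F" "\<And>x. absv x \<le> c \<Longrightarrow> \<exists>f\<in>F. absv (x - f) \<le> c * inverse (real q ^ n)"
    by blast
  obtain G where G: "finite G" "\<And>x. absv x \<le> 1 \<Longrightarrow> \<exists>f\<in>G. absv (x - f) \<le> inverse q"
    using finite_residue_net by blast
  have r: "c * inverse (real q ^ n) \<in> powers q"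
    using powers_mult[OF c powers_inverse[OF power_in_powers q_ge_2] q_ge_2] .
  then obtain a where a: "a \<noteq> 0" "absv a = c * inverse (real q ^ n)"
    using ex_absv_eq by blast
  have pos: "absv a > 0"
    using a r powers_pos q_ge_2 by simp
  have "\<exists>h\<in>(\<lambda>(f, g). f + a * g) ` (F \<times> G). absv (x - h) \<le> c * inverse (real q ^ Suc n)" if x: "absv x \<le> c" for x
  proof -
    obtain f where f: "f \<in> F" "absv (x - f) \<le> absv a"
      using F(2)[OF x] a by auto
    then have "absv (inverse a * (x - f)) \<le> 1"
      unfolding absv_mult absv_inverse using pos by (simp add: field_simps)
    then obtain g where g: "g \<in> G" "absv (inverse a * (x - f) - g) \<le> inverse q"
      using G(2) by blast
    have "x - (f + a * g) = a * (inverse a * (x - f) - g)"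
      using a by (simp add: field_simps)
    then have "absv (x - (f + a * g)) = absv a * absv (inverse a * (x - f) - g)"
      by (simp only: absv_mult)
    also have "\<dots> \<le> absv a * inverse q"
      using g pos by (intro mult_left_mono) auto
    also have "\<dots> = c * inverse (real q ^ Suc n)"
      by (simp add: a)
    finally show ?thesis
      using f g by force
  qed
  then show ?case
    using F(1) G(1) by (intro exI[of _ "(\<lambda>(f, g). f + a * g) ` (F \<times> G)"]) blast
qed

lemma finite_net:
  obtains F where "finite F" "\<And>x. absv x \<le> real q ^ M \<Longrightarrow> \<exists>f\<in>F. absv (x - f) \<le> inverse (real q ^ m)"
proof -
  have "real q ^ M * inverse (real q ^ (M + m)) = inverse (real q ^ m)"
    using q_pos by (simp add: power_add)
  then show ?thesis
    using that finite_net_scaled[OF power_in_powers, of M "M + m"] by auto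
qed

lemma finite_vec_net:
  obtains F :: "('k ^ 'n) set"
  where "finite F" "\<And>v. std_norm absv v \<le> real q ^ M \<Longrightarrow> \<exists>f\<in>F. std_norm absv (v - f) \<le> inverse (real q ^ m)"
proof -
  obtain F where F: "finite F" "\<And>x. absv x \<le> real q ^ M \<Longrightarrow> \<exists>f\<in>F. absv (x - f) \<le> inverse (real q ^ m)"
    using finite_net by blast
  have "\<exists>f\<in>{v. \<forall>i. v $ i \<in> F}. std_norm absv (v - f) \<le> inverse (real q ^ m)"
    if v: "std_norm absv v \<le> real q ^ M" for v :: "'k ^ 'n"
  proof -
    have "\<forall>i. \<exists>f\<in>F. absv (v $ i - f) \<le> inverse (real q ^ m)"
      using F(2) v unfolding std_norm_le_iff by blast
    then obtain f where "\<And>i. f i \<in> F" "\<And>i. absv (v $ i - f i) \<le> inverse (real q ^ m)"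
      by metis
    then show ?thesis
      by (intro bexI[of _ "\<chi> i. f i"]) (auto simp: std_norm_le_iff)
  qed
  then show ?thesis
    using that[OF finite_vec_components[OF F(1)]] by blast
qed

lemma matrix_dist_le_iff: "matrix_dist absv A B \<le> c \<longleftrightarrow> (\<forall>i j. absv (A $ i $ j - B $ i $ j) \<le> c)"
  unfolding matrix_dist_def by (subst Max_le_iff) auto

lemma matrix_dist_eq_std_norm: "matrix_dist absv A B \<le> c \<longleftrightarrow> (\<forall>i. std_norm absv (A $ i - B $ i) \<le> c)"
  by (simp add: matrix_dist_le_iff std_norm_le_iff)

lemma finite_matrix_net:
  obtains F :: "('k ^ 'n ^ 'n) set"
  where "finite F" "\<And>A. matrix_dist absv A 0 \<le> real q ^ M \<Longrightarrow> \<exists>B\<in>F. matrix_dist absv A B \<le> inverse (real q ^ m)"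
proof -
  obtain F :: "('k ^ 'n) set" where F: "finite F"
    "\<And>v. std_norm absv v \<le> real q ^ M \<Longrightarrow> \<exists>f\<in>F. std_norm absv (v - f) \<le> inverse (real q ^ m)"
    using finite_vec_net by blast
  have "\<exists>B\<in>{B. \<forall>i. B $ i \<in> F}. matrix_dist absv A B \<le> inverse (real q ^ m)"
    if A: "matrix_dist absv A 0 \<le> real q ^ M" for A :: "'k ^ 'n ^ 'n"
  proof -
    have "\<forall>i. \<exists>f\<in>F. std_norm absv (A $ i - f) \<le> inverse (real q ^ m)"
      using F(2) A unfolding matrix_dist_eq_std_norm by simp
    then obtain f where "\<And>i. f i \<in> F" "\<And>i. std_norm absv (A $ i - f i) \<le> inverse (real q ^ m)"
      by metis
    then show ?thesis
      by (intro bexI[of _ "\<chi> i. f i"]) (auto simp: matrix_dist_eq_std_norm)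
  qed
  then show ?thesis
    using that[OF finite_vec_components[OF F(1)]] by blast
qed

text \<open>A norm is determined by its unit ball. Here that ball lies in the standard ball of
  radius \<open>real q ^ m\<close> and contains the one of radius
  \<open>inverse (real q ^ m)\<close>, so it is a union of cosets of the small ball and is
  determined by the points of a finite net that it contains.\<close>

lemma finite_norm_close:
  "finite {\<eta> \<in> building_vertices q absv. norm_close q m (std_norm absv :: 'k ^ 'n \<Rightarrow> real) \<eta>}" (is "finite ?S")
proof -
  obtain F :: "('k ^ 'n) set" where F: "finite F"
    "\<And>v. std_norm absv v \<le> real q ^ m \<Longrightarrow> \<exists>f\<in>F. std_norm absv (v - f) \<le> inverse (real q ^ m)"
    using finite_vec_net by blast
  define trace where "trace \<eta> = {f \<in> F. \<eta> f \<le> 1}" for \<eta> :: "'k ^ 'n \<Rightarrow> real"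
  \<comment> \<open>A net point \<open>f\<close> near \<open>v\<close> differs from it by a vector
    in both unit balls. Hence membership passes from \<open>v\<close> to \<open>f\<close> in one
    ball, across by equality of traces, and back from \<open>f\<close> to \<open>v\<close> in the
    other.\<close>
  have ball: "\<eta>' v \<le> 1"
    if \<eta>: "\<eta> \<in> ?S" and \<eta>': "\<eta>' \<in> ?S" and eq: "trace \<eta> = trace \<eta>'" and v: "\<eta> v \<le> 1" for \<eta> \<eta>' v
  proof -
    note V = conjunct1[OF \<eta>[unfolded mem_Collect_eq]] conjunct1[OF \<eta>'[unfolded mem_Collect_eq]]
    have "std_norm absv v \<le> real q ^ m * \<eta> v"
      using \<eta> by (simp add: norm_close_def)
    also have "\<dots> \<le> real q ^ m * 1"
      using v by (intro mult_left_mono) auto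
    finally obtain f where f: "f \<in> F" "std_norm absv (v - f) \<le> inverse (real q ^ m)"
      using F(2) by auto
    have small: "\<xi> (v - f) \<le> 1" if "\<xi> \<in> ?S" for \<xi>
    proof -
      have "\<xi> (v - f) \<le> real q ^ m * std_norm absv (v - f)"
        using that by (simp add: norm_close_def)
      also have "\<dots> \<le> real q ^ m * inverse (real q ^ m)"
        using f by (intro mult_left_mono) auto
      finally show ?thesis
        using q_pos by simp
    qed
    have "\<eta> (v - (v - f)) \<le> 1"
      using v small[OF \<eta>] by (intro order_trans[OF vertex_diff[OF V(1)]]) simp
    then have "\<eta>' f \<le> 1"
      using f eq by (auto simp: trace_def)
    then have "\<eta>' ((v - f) + f) \<le> 1"
      using small[OF \<eta>'] by (intro order_trans[OF vertex_add[OF V(2)]]) simp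
    then show ?thesis by simp
  qed
  have le: "\<eta>' v \<le> \<eta> v" if \<eta>: "\<eta> \<in> ?S" and \<eta>': "\<eta>' \<in> ?S" and eq: "trace \<eta> = trace \<eta>'" for \<eta> \<eta>' v
  proof -
    note V = conjunct1[OF \<eta>[unfolded mem_Collect_eq]] conjunct1[OF \<eta>'[unfolded mem_Collect_eq]]
    show ?thesis
    proof (cases "v = 0")
      case True
      then show ?thesis
        by (simp add: vertex_zero[OF V(1)] vertex_zero[OF V(2)])
    next
      case False
      have pos: "\<eta> v > 0"
        by (rule vertex_pos[OF V(1) False])
      \<comment> \<open>Scaling \<open>v\<close> to norm 1 reduces the comparison of norms to that
        of unit balls.\<close>
      obtain x where x: "absv x = inverse (\<eta> v)"
        using ex_absv_eq[OF powers_inverse[OF vertex_in_powers[OF V(1) False] q_ge_2]] by blast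
      have "\<eta> (x *s v) \<le> 1"
        using pos by (simp add: x vertex_scale[OF V(1)])
      then have "\<eta>' (x *s v) \<le> 1"
        by (rule ball[OF \<eta> \<eta>' eq])
      then show ?thesis
        using pos by (simp add: x vertex_scale[OF V(2)] field_simps)
    qed
  qed
  have "inj_on trace ?S"
    by (intro inj_onI ext antisym) (auto intro: le)
  moreover have "finite (trace ` ?S)"
    by (rule finite_subset[of _ "Pow F"]) (auto simp: trace_def F(1))
  ultimately show ?thesis
    by (rule finite_imageD[rotated])
qed

section \<open>Matrices that move a norm by a bounded amount\<close>

lemma std_norm_matrix_le:
  "std_norm absv (A *v v) \<le> matrix_dist absv A 0 * std_norm absv v" for A :: "'k ^ 'n ^ 'n"
proof -
  have nonneg: "matrix_dist absv A 0 \<ge> 0"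
    by (rule Metric_space.nonneg[OF Metric_space_matrix_dist])
  have "std_norm absv (v $ j *s column j A) \<le> matrix_dist absv A 0 * std_norm absv v" for j
  proof -
    have "absv (A $ i $ j) \<le> matrix_dist absv A 0" for i
      using matrix_dist_le_iff[of A 0 "matrix_dist absv A 0"] by simp
    then have "std_norm absv (column j A) \<le> matrix_dist absv A 0"
      by (simp add: std_norm_le_iff column_def)
    then show ?thesis
      unfolding vertex_scale[OF std_norm_vertex] mult.commute[of "absv _"]
      by (intro mult_mono std_norm_ge nonneg absv_nonneg)
  qed
  then show ?thesis
    unfolding matrix_mult_sum
    by (intro vertex_sum_le[OF std_norm_vertex] mult_nonneg_nonneg nonneg vertex_nonneg[OF std_norm_vertex])
qed

text \<open>For nonzero \<open>v\<close>, the correction \<open>(B - A) *v v\<close> has norm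
  strictly below \<open>\<eta>' (A *v v)\<close>, which is bounded below by a multiple of
  \<open>\<eta> v\<close>. By the isosceles property the value does not change at all. The same
  \<open>\<delta>\<close> works for every \<open>A\<close>, which yields closedness as well as
  openness.\<close>

lemma norm_close_matrix_uniform:
  fixes \<eta> \<eta>' :: "'k ^ 'n \<Rightarrow> real"
  assumes \<eta>: "\<eta> \<in> building_vertices q absv" and \<eta>': "\<eta>' \<in> building_vertices q absv"
  obtains \<delta> where "\<delta> > 0"
    "\<And>A B :: 'k ^ 'n ^ 'n. matrix_dist absv A B < \<delta> \<Longrightarrow> norm_close q m \<eta> (\<lambda>v. \<eta>' (A *v v)) \<Longrightarrow>
       norm_close q m \<eta> (\<lambda>v. \<eta>' (B *v v))"
proof -
  obtain a where a: "norm_close q a \<eta>' (std_norm absv)"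
    using ex_norm_close[OF \<eta>' std_norm_vertex] .
  obtain b where b: "norm_close q b \<eta> (std_norm absv)"
    using ex_norm_close[OF \<eta> std_norm_vertex] .
  \<comment> \<open>The exponents \<open>a\<close>, \<open>b\<close> and \<open>m\<close> pay for
    passing from \<open>\<eta>'\<close> to the standard norm, from the standard norm to
    \<open>\<eta>\<close>, and from \<open>\<eta>\<close> to \<open>\<eta>'\<close> after
    \<open>A\<close>.\<close>
  define \<delta> where "\<delta> = inverse (real q ^ (a + b + m))"
  have "norm_close q m \<eta> (\<lambda>v. \<eta>' (B *v v))"
    if AB: "matrix_dist absv A B < \<delta>" and A: "norm_close q m \<eta> (\<lambda>v. \<eta>' (A *v v))" for A B :: "'k ^ 'n ^ 'n"
  proof -
    have "\<eta>' (B *v v) = \<eta>' (A *v v)" for v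
    proof (cases "v = 0")
      case False
      have "matrix_dist absv (B - A) 0 = matrix_dist absv B A"
        by (simp add: matrix_dist_def)
      then have BA: "matrix_dist absv (B - A) 0 < \<delta>"
        using AB Metric_space.commute[OF Metric_space_matrix_dist, of A B] by simp
      have "\<eta>' ((B - A) *v v) \<le> real q ^ a * std_norm absv ((B - A) *v v)"
        using a by (simp add: norm_close_def)
      also have "\<dots> \<le> real q ^ a * (matrix_dist absv (B - A) 0 * std_norm absv v)"
        by (intro mult_left_mono std_norm_matrix_le) simp
      also have "\<dots> < real q ^ a * (\<delta> * std_norm absv v)"
        using BA False vertex_pos[OF std_norm_vertex, of v] q_pos by simp
      also have "\<dots> \<le> real q ^ a * (\<delta> * (real q ^ b * \<eta> v))"
        using b by (intro mult_left_mono) (auto simp: norm_close_def \<delta>_def)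
      also have "\<dots> = \<eta> v / real q ^ m"
        using q_pos by (simp add: \<delta>_def power_add field_simps)
      also have "\<dots> \<le> \<eta>' (A *v v)"
        using A q_pos by (simp add: norm_close_def field_simps)
      finally have "\<eta>' (A *v v + (B - A) *v v) = \<eta>' (A *v v)"
        by (rule vertex_add_eq[OF \<eta>'])
      then show ?thesis
        by (simp add: matrix_vector_mult_diff_rdistrib)
    qed simp
    then show ?thesis
      using A by simp
  qed
  moreover have "\<delta> > 0"
    using q_pos by (simp add: \<delta>_def)
  ultimately show ?thesis
    using that by blast
qed

lemma mcomplete_matrix_dist:
  "Metric_space.mcomplete UNIV (matrix_dist absv :: 'k ^ 'n ^ 'n \<Rightarrow> _)"
proof -
  interpret Metric_space UNIV "matrix_dist absv :: 'k ^ 'n ^ 'n \<Rightarrow> _"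
    by (rule Metric_space_matrix_dist)
  show ?thesis
    unfolding mcomplete_def
  proof (intro allI impI)
    fix \<sigma> :: "nat \<Rightarrow> 'k ^ 'n ^ 'n"
    assume "MCauchy \<sigma>"
    moreover have "inverse (real q ^ m) > 0" for m
      using q_pos by simp
    ultimately have "\<forall>m. \<exists>N. \<forall>n n'. N \<le> n \<longrightarrow> N \<le> n' \<longrightarrow> matrix_dist absv (\<sigma> n) (\<sigma> n') < inverse (real q ^ m)"
      unfolding MCauchy_def by blast
    then obtain N where N: "\<And>m n n'. N m \<le> n \<Longrightarrow> N m \<le> n' \<Longrightarrow> matrix_dist absv (\<sigma> n) (\<sigma> n') < inverse (real q ^ m)"
      by metis
    \<comment> \<open>\<open>N\<close> need not be monotone. The partial sums dominate all earlier
      \<open>N i\<close>, so for \<open>m \<le> n\<close> both \<open>K m\<close> and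
      \<open>K n\<close> lie beyond \<open>N m\<close>, as \<open>nested_limit\<close> requires of
      the entries.\<close>
    define K where "K m = (\<Sum>i\<le>m. N i)" for m
    have K: "N m \<le> K n" if "m \<le> n" for m n
      unfolding K_def using that by (intro member_le_sum) auto
    have entry: "absv (\<sigma> n $ i $ j - \<sigma> n' $ i $ j) \<le> inverse (real q ^ m)"
      if "N m \<le> n" "N m \<le> n'" for m n n' i j
      using less_imp_le[OF N[OF that]] matrix_dist_le_iff by blast
    have "\<exists>l. \<forall>m. absv (l - \<sigma> (K m) $ i $ j) \<le> inverse (real q ^ m)" for i j
      by (rule nested_limit) (intro entry K; simp)
    then obtain l where l: "\<And>i j m. absv (l i j - \<sigma> (K m) $ i $ j) \<le> inverse (real q ^ m)"
      by metis
    define L where "L = (\<chi> i j. l i j)"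
    have le: "matrix_dist absv (\<sigma> n) L \<le> inverse (real q ^ m)" if n: "n \<ge> N m" for n m
      unfolding matrix_dist_le_iff
    proof (intro allI)
      fix i j
      have "absv ((\<sigma> n $ i $ j - \<sigma> (K m) $ i $ j) - (l i j - \<sigma> (K m) $ i $ j)) \<le> inverse (real q ^ m)"
        using entry[OF n K[OF order_refl]] l by (intro order_trans[OF absv_diff_ultrametric]) simp
      then show "absv (\<sigma> n $ i $ j - L $ i $ j) \<le> inverse (real q ^ m)"
        by (simp add: L_def)
    qed
    have "\<exists>N. \<forall>n\<ge>N. matrix_dist absv (\<sigma> n) L < \<epsilon>" if "\<epsilon> > 0" for \<epsilon>
    proof -
      obtain m where "\<not> \<epsilon> \<le> inverse (real q ^ m)"
        using le_inverse_powers_imp_le_0[of \<epsilon>] \<open>\<epsilon> > 0\<close> by (meson not_le)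
      then show ?thesis
        using le[of m] by (meson not_le order_le_less_trans)
    qed
    then show "\<exists>x. limitin mtopology \<sigma> x sequentially"
      unfolding limit_metric_sequentially by auto
  qed
qed

lemma openin_norm_close_matrices:
  fixes \<eta> \<eta>' :: "'k ^ 'n \<Rightarrow> real"
  assumes "\<eta> \<in> building_vertices q absv" "\<eta>' \<in> building_vertices q absv"
  shows "openin (Metric_space.mtopology UNIV (matrix_dist absv))
    {A :: 'k ^ 'n ^ 'n. norm_close q m \<eta> (\<lambda>v. \<eta>' (A *v v))}"
proof -
  interpret Metric_space UNIV "matrix_dist absv :: 'k ^ 'n ^ 'n \<Rightarrow> _"
    by (rule Metric_space_matrix_dist)
  obtain \<delta> where "\<delta> > 0"
    "\<And>A B :: 'k ^ 'n ^ 'n. matrix_dist absv A B < \<delta> \<Longrightarrow> norm_close q m \<eta> (\<lambda>v. \<eta>' (A *v v)) \<Longrightarrow>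
       norm_close q m \<eta> (\<lambda>v. \<eta>' (B *v v))"
    using norm_close_matrix_uniform[OF assms] by blast
  then show ?thesis
    unfolding openin_mtopology by auto
qed

lemma compactin_norm_close_matrices:
  fixes \<eta> \<eta>' :: "'k ^ 'n \<Rightarrow> real"
  assumes \<eta>: "\<eta> \<in> building_vertices q absv" and \<eta>': "\<eta>' \<in> building_vertices q absv"
  shows "compactin (Metric_space.mtopology UNIV (matrix_dist absv))
    {A :: 'k ^ 'n ^ 'n. norm_close q m \<eta> (\<lambda>v. \<eta>' (A *v v))}"
    (is "compactin _ ?S")
proof -
  interpret Metric_space UNIV "matrix_dist absv :: 'k ^ 'n ^ 'n \<Rightarrow> _"
    by (rule Metric_space_matrix_dist)
  obtain \<delta> where \<delta>: "\<delta> > 0"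
    "\<And>A B :: 'k ^ 'n ^ 'n. matrix_dist absv A B < \<delta> \<Longrightarrow> norm_close q m \<eta> (\<lambda>v. \<eta>' (A *v v)) \<Longrightarrow>
       norm_close q m \<eta> (\<lambda>v. \<eta>' (B *v v))"
    using norm_close_matrix_uniform[OF assms] by blast
  \<comment> \<open>The uniform \<open>\<delta>\<close> serves the complement too: a member of
    \<open>?S\<close> within \<open>\<delta>\<close> of \<open>A\<close> would force
    \<open>A\<close> into \<open>?S\<close>.\<close>
  have "closedin mtopology ?S"
    unfolding closedin_metric
  proof (intro conjI allI impI exI)
    fix A assume "A \<in> UNIV - ?S"
    then show "disjnt ?S (mball A \<delta>)"
      using \<delta>(2) by (auto simp: disjnt_iff commute)
  qed (use \<delta>(1) in auto)
  obtain a where a: "norm_close q a \<eta>' (std_norm absv)"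
    using ex_norm_close[OF \<eta>' std_norm_vertex] .
  obtain b where b: "norm_close q b \<eta> (std_norm absv)"
    using ex_norm_close[OF \<eta> std_norm_vertex] .
  \<comment> \<open>Columns are images of unit vectors, whose standard norm is at most 1. The
    exponents pay for the passages from the standard norm to \<open>\<eta>'\<close>, to
    \<open>\<eta>\<close>, and back to the standard norm.\<close>
  have bounded: "matrix_dist absv A 0 \<le> real q ^ (a + m + b)" if A: "A \<in> ?S" for A
    unfolding matrix_dist_le_iff
  proof (intro allI)
    fix i j
    have "A *v axis j 1 = column j A"
      by (simp add: matrix_vector_mult_def axis_def column_def if_distrib[of "(*) _"] cong: if_cong)
    then have "absv (A $ i $ j) \<le> std_norm absv (A *v axis j 1)"
      using std_norm_ge[of "column j A" i] by (simp add: column_def)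
    also have "\<dots> \<le> real q ^ a * \<eta>' (A *v axis j 1)"
      using a by (simp add: norm_close_def)
    also have "\<dots> \<le> real q ^ a * (real q ^ m * \<eta> (axis j 1))"
      using A by (intro mult_left_mono) (auto simp: norm_close_def)
    also have "\<dots> \<le> real q ^ a * (real q ^ m * (real q ^ b * std_norm absv (axis j 1 :: 'k ^ 'n)))"
      using b by (intro mult_left_mono) (auto simp: norm_close_def)
    also have "\<dots> \<le> real q ^ a * (real q ^ m * (real q ^ b * 1))"
      by (intro mult_left_mono) (auto simp: std_norm_le_iff axis_def)
    finally show "absv (A $ i $ j - 0 $ i $ j) \<le> real q ^ (a + m + b)"
      by (simp add: power_add)
  qed
  have "mtotally_bounded ?S"
  proof (rule mtotally_bounded_if_finite_nets)
    fix \<epsilon> :: real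
    assume "\<epsilon> > 0"
    then obtain n where n: "inverse (real q ^ n) < \<epsilon>"
      using le_inverse_powers_imp_le_0[of \<epsilon>] by (meson not_le)
    obtain F :: "('k ^ 'n ^ 'n) set" where F: "finite F"
      "\<And>A. matrix_dist absv A 0 \<le> real q ^ (a + m + b) \<Longrightarrow> \<exists>B\<in>F. matrix_dist absv A B \<le> inverse (real q ^ n)"
      using finite_matrix_net by blast
    have "?S \<subseteq> (\<Union>B\<in>F. mball B \<epsilon>)"
    proof
      fix A assume "A \<in> ?S"
      then obtain B where "B \<in> F" "matrix_dist absv A B \<le> inverse (real q ^ n)"
        using F(2)[OF bounded] by blast
      with n show "A \<in> (\<Union>B\<in>F. mball B \<epsilon>)"
        by (auto simp: commute intro!: bexI[of _ B])
    qed
    with F(1) show "\<exists>F. finite F \<and> F \<subseteq> UNIV \<and> ?S \<subseteq> (\<Union>x\<in>F. mball x \<epsilon>)"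
      by blast
  qed simp
  then have "compactin mtopology (mtopology closure_of ?S)"
    using mtotally_bounded_eq_compact_closure_of[OF mcomplete_matrix_dist] by blast
  then show ?thesis
    using \<open>closedin mtopology ?S\<close> by (simp add: closure_of_closedin)
qed

end

section \<open>The action of the general linear group\<close>

lemma matrix_inv_unique: "matrix_inv A = B" if "A ** B = mat 1" "B ** A = mat 1"
  for A B :: "'k::field ^ 'n ^ 'n"
proof -
  have "invertible A"
    using that by (auto simp: invertible_def)
  then have "matrix_inv A ** (A ** B) = B"
    by (simp add: matrix_mul_assoc matrix_inv_cancel)
  with that show ?thesis by simp
qed

lemma matrix_inv_mult: "matrix_inv (A ** B) = matrix_inv B ** matrix_inv A"
  if "invertible A" "invertible B" for A B :: "'k::field ^ 'n ^ 'n"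
proof (rule matrix_inv_unique)
  have "A ** B ** (matrix_inv B ** matrix_inv A) = A ** (B ** matrix_inv B) ** matrix_inv A"
    by (simp add: matrix_mul_assoc)
  then show "A ** B ** (matrix_inv B ** matrix_inv A) = mat 1"
    using that by (simp add: matrix_inv_cancel)
  have "matrix_inv B ** matrix_inv A ** (A ** B) = matrix_inv B ** (matrix_inv A ** A) ** B"
    by (simp add: matrix_mul_assoc)
  then show "matrix_inv B ** matrix_inv A ** (A ** B) = mat 1"
    using that by (simp add: matrix_inv_cancel)
qed

lemma matrix_inv_inv: "matrix_inv (matrix_inv A) = A" if "invertible A" for A :: "'k::field ^ 'n ^ 'n"
  using matrix_inv_cancel[OF that] by (intro matrix_inv_unique)

lemma group_GL: "group (GL :: ('k::field ^ 'n ^ 'n) monoid)"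
proof (rule groupI)
  fix A :: "'k ^ 'n ^ 'n"
  assume "A \<in> carrier GL"
  then show "\<exists>B\<in>carrier GL. B \<otimes>\<^bsub>GL\<^esub> A = \<one>\<^bsub>GL\<^esub>"
    using matrix_inv_cancel invertible_matrix_inv by (fastforce simp: GL_def)
next
  show "\<one>\<^bsub>GL\<^esub> \<in> carrier (GL :: ('k ^ 'n ^ 'n) monoid)"
    by (auto simp: GL_def invertible_def intro!: exI[of _ "mat 1"])
qed (auto simp: GL_def invertible_mult matrix_mul_assoc)

lemma norm_close_comp_matrix_iff:
  "norm_close q m (\<lambda>v. \<eta> (A *v v)) (\<lambda>v. \<eta>' (A *v v)) \<longleftrightarrow> norm_close q m \<eta> \<eta>'"
  if "invertible A" for A :: "'k::field ^ 'n ^ 'n"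
  unfolding norm_close_def using matrix_inv_cancel(3)[OF that] by metis

context ultrametric_local_field begin

lemma GL_action_eq: "GL_action q absv A \<eta> = (\<lambda>v. \<eta> (matrix_inv A *v v))"
  if "\<eta> \<in> building_vertices q absv"
  using that by (simp add: GL_action_def fun_eq_iff)

lemma GL_action_vertex:
  fixes \<eta> :: "'k ^ 'n \<Rightarrow> real"
  assumes "invertible A" "\<eta> \<in> building_vertices q absv"
  shows "GL_action q absv A \<eta> \<in> building_vertices q absv"
  using assms by (simp add: GL_action_eq vertex_comp_matrix invertible_matrix_inv)

lemma GL_action_mult:
  fixes \<eta> :: "'k ^ 'n \<Rightarrow> real"
  assumes "invertible A" "invertible B" "\<eta> \<in> building_vertices q absv"
  shows "GL_action q absv (A ** B) \<eta> = GL_action q absv A (GL_action q absv B \<eta>)"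
  using assms GL_action_vertex[OF assms(2,3)]
  by (simp add: GL_action_eq matrix_inv_mult matrix_vector_mul_assoc)

lemma GL_action_one: "GL_action q absv (mat 1) \<eta> = \<eta>"
  if "\<eta> \<in> building_vertices q absv" for \<eta> :: "'k ^ 'n \<Rightarrow> real"
  using that matrix_inv_unique[of "mat 1 :: 'k ^ 'n ^ 'n" "mat 1"] by (simp add: GL_action_eq)

lemma GL_action_inv:
  fixes \<eta> :: "'k ^ 'n \<Rightarrow> real"
  assumes "invertible A" "\<eta> \<in> building_vertices q absv"
  shows "GL_action q absv A (GL_action q absv (matrix_inv A) \<eta>) = \<eta>"
    and "GL_action q absv (matrix_inv A) (GL_action q absv A \<eta>) = \<eta>"
  using assms invertible_matrix_inv[OF assms(1)]
  by (simp_all add: GL_action_one matrix_inv_cancel flip: GL_action_mult)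

lemma norm_close_GL_action_iff:
  fixes \<eta> \<eta>' :: "'k ^ 'n \<Rightarrow> real"
  assumes "invertible A" "\<eta> \<in> building_vertices q absv" "\<eta>' \<in> building_vertices q absv"
  shows "norm_close q m (GL_action q absv A \<eta>) (GL_action q absv A \<eta>') \<longleftrightarrow> norm_close q m \<eta> \<eta>'"
  using assms by (simp add: GL_action_eq norm_close_comp_matrix_iff invertible_matrix_inv)

lemma parcs_GL_action_iff:
  fixes \<eta> \<eta>' :: "'k ^ 'n \<Rightarrow> real"
  assumes "invertible A" "\<eta> \<in> building_vertices q absv" "\<eta>' \<in> building_vertices q absv"
  shows "(GL_action q absv A \<eta>, GL_action q absv A \<eta>') \<in> parcs (thickening q absv) \<longleftrightarrow>
    (\<eta>, \<eta>') \<in> parcs (thickening q absv)"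
  using assms GL_action_inv(2)[OF assms(1)]
  by (auto simp: parcs_thickening_iff GL_action_vertex norm_close_GL_action_iff) metis+

theorem GL_acts_by_automorphisms:
  "acts_by_automorphisms (GL :: ('k ^ 'n ^ 'n) monoid) (thickening q absv) (GL_action q absv)"
  unfolding acts_by_automorphisms_def pverts_thickening
proof (intro conjI ballI)
  let ?V = "building_vertices q absv :: ('k ^ 'n \<Rightarrow> real) set"
  have bij: "GL_action q absv A \<in> Bij ?V" if "invertible A" for A :: "'k ^ 'n ^ 'n"
  proof -
    have "bij_betw (GL_action q absv A) ?V ?V"
      using that invertible_matrix_inv[OF that]
      by (intro bij_betw_byWitness[of _ "GL_action q absv (matrix_inv A)"])
        (auto simp: GL_action_inv GL_action_vertex)
    then show ?thesis
      by (auto simp: Bij_def GL_action_def)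
  qed
  have "GL_action q absv (A ** B) = compose ?V (GL_action q absv A) (GL_action q absv B)"
    if "invertible A" "invertible B" for A B :: "'k ^ 'n ^ 'n"
  proof
    fix \<eta>
    show "GL_action q absv (A ** B) \<eta> = compose ?V (GL_action q absv A) (GL_action q absv B) \<eta>"
    proof (cases "\<eta> \<in> ?V")
      case True
      then show ?thesis
        by (simp add: compose_def GL_action_mult[OF that])
    next
      case False
      then show ?thesis
        by (simp add: compose_def GL_action_def)
    qed
  qed
  then have "GL_action q absv \<in> hom (GL :: ('k ^ 'n ^ 'n) monoid) (BijGroup ?V)"
    using bij by (auto simp: hom_def GL_def BijGroup_def)
  then show "group_action (GL :: ('k ^ 'n ^ 'n) monoid) ?V (GL_action q absv)"
    unfolding group_action_def group_hom_def group_hom_axioms_def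
    using group_GL group_BijGroup by blast
qed (simp add: GL_def parcs_GL_action_iff)

text \<open>One direction is the triangle inequality; the other is the Helly property for the balls
  around \<open>\<eta>\<close> and its image. The right-hand side contains no inverse and excludes a
  kernel, so it describes the same set within the space of all matrices.\<close>

lemma GL_moves_ball_iff:
  fixes \<eta> :: "'k ^ 'n \<Rightarrow> real"
  assumes \<eta>: "\<eta> \<in> building_vertices q absv"
  shows "A \<in> carrier GL \<and> GL_action q absv A ` combinatorial_ball (thickening q absv) \<eta> r \<inter>
      combinatorial_ball (thickening q absv) \<eta> r \<noteq> {} \<longleftrightarrow>
    norm_close q (r + r) \<eta> (\<lambda>v. \<eta> (A *v v))"
    (is "_ \<and> ?meets \<longleftrightarrow> ?close")
proof -
  have "invertible A" if ?close
  proof -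
    have "v = 0" if "A *v v = 0" for v
    proof -
      have "\<eta> v \<le> real q ^ (r + r) * \<eta> (A *v v)"
        using \<open>?close\<close> by (simp add: norm_close_def)
      then show ?thesis
        using that vertex_nonneg[OF \<eta>, of v] vertex_eq_0_iff[OF \<eta>, of v] by (simp add: vertex_zero[OF \<eta>])
    qed
    then show ?thesis
      using invertible_left_inverse matrix_left_invertible_ker by blast
  qed
  moreover have "?meets \<longleftrightarrow> ?close" if A: "invertible A"
  proof -
    let ?\<eta>A = "GL_action q absv A \<eta>"
    have \<eta>A: "?\<eta>A \<in> building_vertices q absv"
      by (rule GL_action_vertex[OF A \<eta>])
    \<comment> \<open>Composing both norms with \<open>A\<close> removes the inverse hidden in the
      action.\<close>
    have "norm_close q (r + r) ?\<eta>A \<eta> \<longleftrightarrow>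
        norm_close q (r + r) (\<lambda>v. ?\<eta>A (A *v v)) (\<lambda>v. \<eta> (A *v v))"
      using norm_close_comp_matrix_iff[OF A] by blast
    also have "\<dots> \<longleftrightarrow> ?close"
      using A \<eta> by (simp add: GL_action_eq matrix_inv_cancel)
    finally have close_iff: "norm_close q (r + r) ?\<eta>A \<eta> \<longleftrightarrow> ?close" .
    have "?meets \<longleftrightarrow> norm_close q (r + r) ?\<eta>A \<eta>"
    proof
      assume ?meets
      then obtain \<zeta> where \<zeta>: "\<zeta> \<in> building_vertices q absv" "norm_close q r \<eta> \<zeta>"
        "norm_close q r \<eta> (GL_action q absv A \<zeta>)"
        by (auto simp: combinatorial_ball_eq[OF \<eta>])
      then have "norm_close q r ?\<eta>A (GL_action q absv A \<zeta>)"
        using norm_close_GL_action_iff[OF A \<eta>] by blast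
      moreover have "norm_close q r (GL_action q absv A \<zeta>) \<eta>"
        using \<zeta>(3) by (simp only: norm_close_sym)
      ultimately show "norm_close q (r + r) ?\<eta>A \<eta>"
        by (rule norm_close_trans)
    next
      assume close: "norm_close q (r + r) ?\<eta>A \<eta>"
      define I where "I = {(?\<eta>A, r), (\<eta>, r)}"
      have refl: "norm_close q (r + r) \<xi> \<xi>" if "\<xi> \<in> building_vertices q absv" for \<xi> :: "'k ^ 'n \<Rightarrow> real"
        by (rule norm_close_mono[OF that that, of 0]) (simp_all add: norm_close_0_iff)
      have "fst ` I \<subseteq> building_vertices q absv"
        using \<eta> \<eta>A by (simp add: I_def)
      moreover have "norm_close q (s + s') \<xi> \<xi>'" if "(\<xi>, s) \<in> I" "(\<xi>', s') \<in> I" for \<xi> \<xi>' s s'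
        using that close close[unfolded norm_close_sym[of _ _ ?\<eta>A]] refl[OF \<eta>] refl[OF \<eta>A]
        unfolding I_def by blast
      ultimately obtain \<zeta> where \<zeta>: "\<zeta> \<in> building_vertices q absv"
        "\<And>\<xi> s. (\<xi>, s) \<in> I \<Longrightarrow> norm_close q s \<xi> \<zeta>"
        by (rule norm_close_helly) auto
      \<comment> \<open>The common point \<open>\<zeta>\<close> must be the image of a point of the
        ball around \<open>\<eta>\<close>; pulling it back by the isometry \<open>A\<close> gives
        that point.\<close>
      define \<zeta>' where "\<zeta>' = GL_action q absv (matrix_inv A) \<zeta>"
      have \<zeta>': "\<zeta>' \<in> building_vertices q absv" "GL_action q absv A \<zeta>' = \<zeta>"
        unfolding \<zeta>'_def using \<zeta>(1) A
        by (simp_all add: GL_action_inv GL_action_vertex invertible_matrix_inv)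
      have "norm_close q r ?\<eta>A (GL_action q absv A \<zeta>')" "norm_close q r \<eta> (GL_action q absv A \<zeta>')"
        unfolding \<zeta>'(2) by (simp_all add: \<zeta>(2) I_def)
      then have "norm_close q r \<eta> \<zeta>'" "norm_close q r \<eta> \<zeta>"
        using norm_close_GL_action_iff[OF A \<eta> \<zeta>'(1)] \<zeta>'(2) by auto
      then show ?meets
        using \<zeta>(1) \<zeta>' unfolding combinatorial_ball_eq[OF \<eta>] by blast
    qed
    then show ?thesis
      unfolding close_iff .
  qed
  ultimately show ?thesis
    by (auto simp: GL_def)
qed

text \<open>The exponent 0 expresses the fibres of orbit maps in the form for which openness is
  known.\<close>

lemma GL_action_eq_iff:
  fixes \<eta> \<eta>' :: "'k ^ 'n \<Rightarrow> real"
  assumes "invertible A" "\<eta> \<in> building_vertices q absv"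
  shows "GL_action q absv A \<eta> = \<eta>' \<longleftrightarrow> norm_close q 0 \<eta> (\<lambda>v. \<eta>' (A *v v))"
  unfolding norm_close_0_iff GL_action_eq[OF assms(2)] fun_eq_iff
  using matrix_inv_cancel(3,4)[OF assms(1)] by metis

theorem GL_acts_properly:
  "acts_properly (GL :: ('k ^ 'n ^ 'n) monoid) (GL_topology absv) (thickening q absv) (GL_action q absv)"
  unfolding acts_properly_def
proof (intro conjI ballI allI)
  interpret Metric_space UNIV "matrix_dist absv :: 'k ^ 'n ^ 'n \<Rightarrow> _"
    by (rule Metric_space_matrix_dist)
  let ?V = "building_vertices q absv :: ('k ^ 'n \<Rightarrow> real) set"
  show "compactin (GL_topology absv)
      {A \<in> carrier (GL :: ('k ^ 'n ^ 'n) monoid). GL_action q absv A ` combinatorial_ball (thickening q absv) \<eta> r \<inter>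
        combinatorial_ball (thickening q absv) \<eta> r \<noteq> {}}"
    if "\<eta> \<in> pverts (thickening q absv)" for \<eta> r
  proof -
    have \<eta>: "\<eta> \<in> ?V"
      using that by simp
    have "compactin mtopology {A \<in> carrier (GL :: ('k ^ 'n ^ 'n) monoid).
        GL_action q absv A ` combinatorial_ball (thickening q absv) \<eta> r \<inter>
        combinatorial_ball (thickening q absv) \<eta> r \<noteq> {}}"
      unfolding GL_moves_ball_iff[OF \<eta>] by (rule compactin_norm_close_matrices[OF \<eta> \<eta>])
    then show ?thesis
      unfolding GL_topology_def compactin_subtopology by auto
  qed
  \<comment> \<open>Orbit maps are locally constant, which is continuity jointly with a discrete
    space of vertices.\<close>
  have open_fiber: "openin (GL_topology absv) {B \<in> carrier GL. GL_action q absv B \<eta> = GL_action q absv A \<eta>}"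
    if A: "A \<in> carrier GL" and \<eta>: "\<eta> \<in> ?V" for A :: "'k ^ 'n ^ 'n" and \<eta>
  proof -
    have "GL_action q absv A \<eta> \<in> ?V"
      using A \<eta> by (simp add: GL_def GL_action_vertex)
    then have "openin mtopology {B :: 'k ^ 'n ^ 'n. norm_close q 0 \<eta> (\<lambda>v. GL_action q absv A \<eta> (B *v v))}"
      by (rule openin_norm_close_matrices[OF \<eta>])
    moreover have "{B \<in> carrier GL. GL_action q absv B \<eta> = GL_action q absv A \<eta>} =
        {B. norm_close q 0 \<eta> (\<lambda>v. GL_action q absv A \<eta> (B *v v))} \<inter> carrier GL"
      using GL_action_eq_iff[OF _ \<eta>] by (auto simp: GL_def)
    ultimately show ?thesis
      unfolding GL_topology_def openin_subtopology by blast
  qed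
  have topspace: "topspace (GL_topology absv) = carrier (GL :: ('k ^ 'n ^ 'n) monoid)"
    by (simp add: GL_topology_def)
  show "continuous_map (prod_topology (GL_topology absv) (discrete_topology (pverts (thickening q absv))))
      (discrete_topology (pverts (thickening q absv)))
      (\<lambda>(A, \<eta>). GL_action q absv (A :: 'k ^ 'n ^ 'n) \<eta>)"
    unfolding continuous_map_def pverts_thickening topspace_prod_topology topspace_discrete_topology topspace
  proof (intro conjI allI impI)
    show "(\<lambda>(A, \<eta>). GL_action q absv A \<eta>) \<in> carrier (GL :: ('k ^ 'n ^ 'n) monoid) \<times> ?V \<rightarrow> ?V"
      by (auto simp: GL_def GL_action_vertex)
    fix U assume "openin (discrete_topology ?V) U"
    show "openin (prod_topology (GL_topology absv) (discrete_topology ?V))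
        {x \<in> carrier GL \<times> ?V. (case x of (A, \<eta>) \<Rightarrow> GL_action q absv A \<eta>) \<in> U}"
      unfolding openin_prod_topology_alt
    proof (intro allI impI)
      fix A :: "'k ^ 'n ^ 'n" and \<eta>
      assume "(A, \<eta>) \<in> {x \<in> carrier GL \<times> ?V. (case x of (A, \<eta>) \<Rightarrow> GL_action q absv A \<eta>) \<in> U}"
      then have A: "A \<in> carrier GL" "\<eta> \<in> ?V" "GL_action q absv A \<eta> \<in> U"
        by auto
      with open_fiber[OF A(1,2)] show "\<exists>W W'. openin (GL_topology absv) W \<and> openin (discrete_topology ?V) W' \<and> A \<in> W \<and> \<eta> \<in> W' \<and>
          W \<times> W' \<subseteq> {x \<in> carrier GL \<times> ?V. (case x of (A, \<eta>) \<Rightarrow> GL_action q absv A \<eta>) \<in> U}"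
        by (intro exI[of _ "{B \<in> carrier GL. GL_action q absv B \<eta> = GL_action q absv A \<eta>}"] exI[of _ "{\<eta>}"]) auto
    qed
  qed
qed

section \<open>Orbits of vertices and edges\<close>

lemma orbit_GL_action:
  fixes \<eta> \<eta>' :: "'k ^ 'n \<Rightarrow> real"
  assumes A: "invertible A" and \<eta>: "\<eta> \<in> building_vertices q absv" "\<eta>' \<in> building_vertices q absv"
  shows "orbit GL (\<lambda>B. map_prod (GL_action q absv B) (GL_action q absv B)) (GL_action q absv A \<eta>, GL_action q absv A \<eta>') =
    orbit GL (\<lambda>B. map_prod (GL_action q absv B) (GL_action q absv B)) (\<eta>, \<eta>')" (is "?L = ?R")
proof
  show "?L \<subseteq> ?R"
  proof
    fix x assume "x \<in> ?L"
    then obtain B where B: "invertible B" "x = (GL_action q absv B (GL_action q absv A \<eta>), GL_action q absv B (GL_action q absv A \<eta>'))"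
      by (auto simp: orbit_def GL_def)
    then have "x = map_prod (GL_action q absv (B ** A)) (GL_action q absv (B ** A)) (\<eta>, \<eta>')"
      using A \<eta> by (simp add: GL_action_mult)
    moreover have "invertible (B ** A)"
      using A B invertible_mult by blast
    ultimately show "x \<in> ?R"
      unfolding orbit_def GL_def by auto
  qed
  show "?R \<subseteq> ?L"
  proof
    fix x assume "x \<in> ?R"
    then obtain B where B: "invertible B" "x = (GL_action q absv B \<eta>, GL_action q absv B \<eta>')"
      by (auto simp: orbit_def GL_def)
    let ?C = "B ** matrix_inv A"
    have "x = map_prod (GL_action q absv ?C) (GL_action q absv ?C) (GL_action q absv A \<eta>, GL_action q absv A \<eta>')"
      using A B \<eta> by (simp add: GL_action_mult GL_action_vertex GL_action_inv invertible_matrix_inv)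
    moreover have "invertible ?C"
      using A B invertible_mult invertible_matrix_inv by blast
    ultimately show "x \<in> ?L"
      unfolding orbit_def GL_def by auto
  qed
qed

lemma GL_transitive:
  fixes \<eta> :: "'k ^ 'n \<Rightarrow> real"
  assumes \<eta>: "\<eta> \<in> building_vertices q absv"
  obtains A where "invertible A" "GL_action q absv A \<eta> = std_norm absv"
proof -
  obtain A :: "'k ^ 'n ^ 'n" where A: "invertible A" "\<And>v. \<eta> (A *v v) = std_norm absv v"
    using vertex_eq_std_norm[OF \<eta>] by blast
  have "GL_action q absv (matrix_inv A) \<eta> = std_norm absv"
    using \<eta> A by (simp add: GL_action_eq matrix_inv_inv fun_eq_iff)
  with that invertible_matrix_inv[OF A(1)] show ?thesis by blast
qed

theorem GL_acts_cocompactly: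
  "acts_cocompactly (GL :: ('k ^ 'n ^ 'n) monoid) (thickening q absv) (GL_action q absv)"
  unfolding acts_cocompactly_def
proof
  let ?V = "building_vertices q absv :: ('k ^ 'n \<Rightarrow> real) set"
  let ?S = "std_norm absv :: 'k ^ 'n \<Rightarrow> real"
  let ?orb = "orbit (GL :: ('k ^ 'n ^ 'n) monoid) (\<lambda>B. map_prod (GL_action q absv B) (GL_action q absv B))"
  \<comment> \<open>Transitivity moves the first vertex of a pair to the standard norm, leaving
    finitely many choices for the second. The case \<open>m = 1\<close> covers edges, and
    \<open>m = 0\<close> with equal entries covers vertices.\<close>
  have orb: "\<exists>\<zeta>\<in>{\<zeta> \<in> ?V. norm_close q m ?S \<zeta>}. ?orb (\<eta>, \<eta>') = ?orb (?S, \<zeta>)"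
    if \<eta>: "\<eta> \<in> ?V" "\<eta>' \<in> ?V" and close: "norm_close q m \<eta> \<eta>'" for \<eta> \<eta>' m
  proof -
    obtain A where A: "invertible A" "GL_action q absv A \<eta> = ?S"
      using GL_transitive[OF \<eta>(1)] by blast
    have "norm_close q m ?S (GL_action q absv A \<eta>')"
      using close norm_close_GL_action_iff[OF A(1) \<eta>] A(2) by simp
    moreover have "?orb (\<eta>, \<eta>') = ?orb (?S, GL_action q absv A \<eta>')"
      using orbit_GL_action[OF A(1) \<eta>] A(2) by simp
    ultimately show ?thesis
      using GL_action_vertex[OF A(1) \<eta>(2)] by blast
  qed
  have "orbits GL (parcs (thickening q absv)) (\<lambda>B. map_prod (GL_action q absv (B :: 'k ^ 'n ^ 'n)) (GL_action q absv B)) \<subseteq>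
      (\<lambda>\<zeta>. ?orb (?S, \<zeta>)) ` {\<zeta> \<in> ?V. norm_close q 1 ?S \<zeta>}"
  proof
    fix X assume "X \<in> orbits GL (parcs (thickening q absv)) (\<lambda>B. map_prod (GL_action q absv (B :: 'k ^ 'n ^ 'n)) (GL_action q absv B))"
    then obtain \<eta> \<eta>' where "X = ?orb (\<eta>, \<eta>')" "(\<eta>, \<eta>') \<in> parcs (thickening q absv)"
      unfolding orbits_def by auto
    with orb[of \<eta> \<eta>' 1] show "X \<in> (\<lambda>\<zeta>. ?orb (?S, \<zeta>)) ` {\<zeta> \<in> ?V. norm_close q 1 ?S \<zeta>}"
      unfolding parcs_thickening_iff by blast
  qed
  then show "finite (orbits GL (parcs (thickening q absv)) (\<lambda>B. map_prod (GL_action q absv (B :: 'k ^ 'n ^ 'n)) (GL_action q absv B)))"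
    using finite_norm_close by (rule finite_subset[OF _ finite_imageI])
  \<comment> \<open>A vertex orbit is the projection of the orbit of a diagonal pair, so the
    statement about pairs settles vertices as well.\<close>
  have fst_orb: "orbit GL (GL_action q absv) \<eta> = fst ` ?orb (\<eta>, \<eta>)" for \<eta>
    by (force simp: orbit_def)
  have "orbits (GL :: ('k ^ 'n ^ 'n) monoid) ?V (GL_action q absv) \<subseteq> {orbit GL (GL_action q absv) ?S}"
  proof
    fix X assume "X \<in> orbits (GL :: ('k ^ 'n ^ 'n) monoid) ?V (GL_action q absv)"
    then obtain \<eta> where \<eta>: "\<eta> \<in> ?V" "X = orbit GL (GL_action q absv) \<eta>"
      unfolding orbits_def by auto
    have "norm_close q 0 \<eta> \<eta>"
      by (simp add: norm_close_0_iff)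
    then have "?orb (\<eta>, \<eta>) = ?orb (?S, ?S)"
      using orb[OF \<eta>(1,1), of 0] by (simp add: norm_close_0_iff)
    then show "X \<in> {orbit GL (GL_action q absv) ?S}"
      by (simp only: \<eta>(2) fst_orb singleton_iff)
  qed
  then show "finite (orbits (GL :: ('k ^ 'n ^ 'n) monoid) (pverts (thickening q absv)) (GL_action q absv))"
    unfolding pverts_thickening by (rule finite_subset) simp
qed

end

text \<open>The classes of 0 and 1 differ because \<open>absv (0 - 1) = 1\<close>. This provides
  \<open>q_ge_2\<close>, on which the discreteness of the value set rests.\<close>

lemma card_residue_field_ge_2:
  assumes "nonarch_valued_field absv" "finite (residue_field absv)"
  shows "card (residue_field absv) \<ge> 2"
proof -
  interpret nonarch_valued_field absv by fact
  define R where "R = {(x, y). x \<in> valuation_ring absv \<and> y \<in> valuation_ring absv \<and> absv (x - y) < 1}"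
  have [simp]: "absv 0 = 0" "absv 1 = 1"
    using absv_mult[of 1 1] absv_eq_0_iff[of 1] absv_eq_0_iff[of 0] by simp_all
  have "{R `` {0}, R `` {1}} \<subseteq> residue_field absv"
    unfolding residue_field_def R_def[symmetric]
    by (auto intro!: quotientI simp: valuation_ring_def)
  moreover have "1 \<in> R `` {1}" "1 \<notin> R `` {0}"
    by (auto simp: R_def valuation_ring_def absv_minus)
  then have "card {R `` {0}, R `` {1}} = 2"
    by (subst card_2_iff) blast
  ultimately show ?thesis
    using card_mono[OF assms(2)] by metis
qed

theorem theorem3:
  fixes absv :: "'k::field \<Rightarrow> real" and q :: nat
  assumes "nonarch_valued_field absv"
    and "spherically_complete absv"
    and "finite (residue_field absv)"
    and "q = card (residue_field absv)"
    and "absv ` (UNIV - {0}) = range (\<lambda>m::int. real q powi m)"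
  shows "helly_graph (thickening q absv :: ('k ^ 'n \<Rightarrow> real) pair_pre_digraph) \<and>
    acts_by_automorphisms (GL :: ('k ^ 'n ^ 'n) monoid) (thickening q absv) (GL_action q absv) \<and>
    acts_properly (GL :: ('k ^ 'n ^ 'n) monoid) (GL_topology absv) (thickening q absv) (GL_action q absv) \<and>
    acts_cocompactly (GL :: ('k ^ 'n ^ 'n) monoid) (thickening q absv) (GL_action q absv)"
proof -
  have "ultrametric_local_field absv q"
    unfolding ultrametric_local_field_def ultrametric_local_field_axioms_def powers_def
    using assms card_residue_field_ge_2[OF assms(1,3)] by blast
  then interpret ultrametric_local_field absv q .
  show ?thesis
    by (intro conjI helly_thickening GL_acts_by_automorphisms GL_acts_properly GL_acts_cocompactly)
qed

end
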